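(* Let $\Omega\subset\mathbb{H}$ be a symmetric slice domain such that $\Omega\cap\mathbb{C}_{I}$ is simply connected for some (and then any) $I\in\mathbb{S}$, and let $I_0\in\mathbb{S}$. Given $\mu\in\mathcal{S}_{\mathbb{R}}(\Omega)\setminus\{0\}$, there exists $h\in\mathcal{S}_{I_{0}}(\Omega)$ such that $h^{s}=\mu$ if and only if $\mu\geq 0$ on $\Omega\cap\mathbb{R}$ and the order of the real zeros of $\mu$ is even.
   Context: $\mathbb{H}$ is the algebra of quaternions with standard basis $1,i,j,k$, $\mathbb{S}=\{q\in\mathbb{H}: q^2=-1\}$, and $\mathbb{C}_I=\mathrm{Span}_{\mathbb{R}}(1,I)$ for $I\in\mathbb{S}$. A symmetric slice domain $\Omega\subset\mathbb{H}$ is a domain (connected open set) such that $\Omega\cap\mathbb{R}\neq\emptyset$ and, whenever $\alpha+I\beta\in\Omega$ ($\alpha,\beta\in\mathbb{R}$, $I\in\mathbb{S}$), also $\alpha+J\beta\in\Omega$ for all $J\in\mathbb{S}$. A function $f:\Omega\to\mathbb{H}$ is slice regular if for every $J\in\mathbb{S}$ the restriction $f_J$ of $f$ to $\Omega\cap\mathbb{C}_J$ is holomorphic: $\frac12\left(\frac{\partial}{\partial\alpha}+J\frac{\partial}{\partial\beta}\right)f_J(\alpha+J\beta)\equiv0$. $\mathcal{S}(\Omega)$ is the set of slice regular functions on $\Omega$; $\mathcal{S}_{\mathbb{R}}(\Omega)$ is the subset of slice preserving functions, i.e. $f(\Omega\cap\mathbb{C}_I)\subset\mathbb{C}_I$ for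 all $I\in\mathbb{S}$ (these are real valued on $\Omega\cap\mathbb{R}$); $\mathcal{S}_{J}(\Omega)$ is the set of $f\in\mathcal{S}(\Omega)$ with $f(\Omega\cap\mathbb{C}_J)\subset\mathbb{C}_J$. Known fact: every $f\in\mathcal{S}(\Omega)$ is written uniquely as $f=f_0+f_1i+f_2j+f_3k$ with $f_0,\dots,f_3\in\mathcal{S}_{\mathbb{R}}(\Omega)$; its symmetrized function is $f^s=f_0^2+f_1^2+f_2^2+f_3^2\in\mathcal{S}_{\mathbb{R}}(\Omega)$. (If $h\in\mathcal{S}_{I_0}(\Omega)$ then $h=h_0+h_1I_0$ with $h_0,h_1\in\mathcal{S}_{\mathbb{R}}(\Omega)$ and $h^s=h_0^2+h_1^2$.) The order of a real zero $x$ of $\mu$ is the $k\in\mathbb{N}$ with $\mu(q)=(q-x)^k\nu(q)$, $\nu\in\mathcal{S}(\Omega)$, $\nu(x)\neq0$. *)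

theory Defs
  imports "HOL-Analysis.Analysis"
begin

section \<open>The algebra of quaternions\<close>

codatatype quat = Quat (qRe: real) (qIm1: real) (qIm2: real) (qIm3: real)

lemma quat_eq_iff:
  "x = y \<longleftrightarrow> qRe x = qRe y \<and> qIm1 x = qIm1 y \<and> qIm2 x = qIm2 y \<and> qIm3 x = qIm3 y"
  by (auto intro: quat.expand)

instantiation quat :: ring_1
begin

primcorec zero_quat where
  "qRe 0 = 0" | "qIm1 0 = 0" | "qIm2 0 = 0" | "qIm3 0 = 0"

primcorec one_quat where
  "qRe 1 = 1" | "qIm1 1 = 0" | "qIm2 1 = 0" | "qIm3 1 = 0"

primcorec plus_quat where
  "qRe (x + y) = qRe x + qRe y"
| "qIm1 (x + y) = qIm1 x + qIm1 y"
| "qIm2 (x + y) = qIm2 x + qIm2 y"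
| "qIm3 (x + y) = qIm3 x + qIm3 y"

primcorec uminus_quat where
  "qRe (- x) = - qRe x"
| "qIm1 (- x) = - qIm1 x"
| "qIm2 (- x) = - qIm2 x"
| "qIm3 (- x) = - qIm3 x"

primcorec minus_quat where
  "qRe (x - y) = qRe x - qRe y"
| "qIm1 (x - y) = qIm1 x - qIm1 y"
| "qIm2 (x - y) = qIm2 x - qIm2 y"
| "qIm3 (x - y) = qIm3 x - qIm3 y"

primcorec times_quat where
  "qRe (x * y) =
     qRe x * qRe y - qIm1 x * qIm1 y - qIm2 x * qIm2 y - qIm3 x * qIm3 y"
| "qIm1 (x * y) =
     qRe x * qIm1 y + qIm1 x * qRe y + qIm2 x * qIm3 y - qIm3 x * qIm2 y"
| "qIm2 (x * y) =
     qRe x * qIm2 y - qIm1 x * qIm3 y + qIm2 x * qRe y + qIm3 x * qIm1 y"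
| "qIm3 (x * y) =
     qRe x * qIm3 y + qIm1 x * qIm2 y - qIm2 x * qIm1 y + qIm3 x * qRe y"

instance
  by standard (simp_all add: quat_eq_iff algebra_simps)

end

instantiation quat :: real_algebra_1
begin

primcorec scaleR_quat where
  "qRe (scaleR r x) = r * qRe x"
| "qIm1 (scaleR r x) = r * qIm1 x"
| "qIm2 (scaleR r x) = r * qIm2 x"
| "qIm3 (scaleR r x) = r * qIm3 x"

instance
  by standard (simp_all add: quat_eq_iff algebra_simps)

end

instantiation quat :: euclidean_space
begin

definition inner_quat :: "quat \<Rightarrow> quat \<Rightarrow> real" where
  "inner_quat x y = qRe x * qRe y + qIm1 x * qIm1 y + qIm2 x * qIm2 y + qIm3 x * qIm3 y"

definition norm_quat :: "quat \<Rightarrow> real" where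
  "norm_quat x = sqrt ((qRe x)\<^sup>2 + (qIm1 x)\<^sup>2 + (qIm2 x)\<^sup>2 + (qIm3 x)\<^sup>2)"

definition sgn_quat :: "quat \<Rightarrow> quat" where
  "sgn_quat x = x /\<^sub>R norm x"

definition dist_quat :: "quat \<Rightarrow> quat \<Rightarrow> real" where
  "dist_quat x y = norm (x - y)"

definition uniformity_quat :: "(quat \<times> quat) filter" where
  "uniformity_quat = (INF e\<in>{0 <..}. principal {(x, y). dist x y < e})"

definition open_quat :: "quat set \<Rightarrow> bool" where
  "open_quat U \<longleftrightarrow> (\<forall>x\<in>U. eventually (\<lambda>(x', y). x' = x \<longrightarrow> y \<in> U) uniformity)"

definition Basis_quat :: "quat set" where
  "Basis_quat = {Quat 1 0 0 0, Quat 0 1 0 0, Quat 0 0 1 0, Quat 0 0 0 1}"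

instance
proof
  fix x y z :: quat and r :: real
  show "(inner x x = 0) = (x = 0)"
  proof
    assume "inner x x = 0"
    moreover have "0 \<le> qRe x * qRe x" "0 \<le> qIm1 x * qIm1 x" "0 \<le> qIm2 x * qIm2 x" "0 \<le> qIm3 x * qIm3 x"
      by simp_all
    ultimately have "qRe x * qRe x = 0" "qIm1 x * qIm1 x = 0" "qIm2 x * qIm2 x = 0" "qIm3 x * qIm3 x = 0"
      unfolding inner_quat_def by linarith+
    then show "x = 0" by (simp add: quat_eq_iff)
  qed (simp add: inner_quat_def)
  show "(\<forall>u\<in>Basis. inner x u = 0) = (x = 0)"
    unfolding Basis_quat_def ball_simps by (simp add: inner_quat_def) (simp add: quat_eq_iff)
qed (auto simp: inner_quat_def norm_quat_def sgn_quat_def dist_quat_def uniformity_quat_def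
    open_quat_def Basis_quat_def quat_eq_iff algebra_simps power2_eq_square)

end

instance quat :: real_normed_algebra_1
proof
  fix x y :: quat
  have "norm (x * y) = norm x * norm y"
    unfolding norm_quat_def real_sqrt_mult [symmetric]
    by (rule arg_cong [where f = sqrt]) (simp, algebra)
  then show "norm (x * y) \<le> norm x * norm y" by simp
qed (simp add: norm_quat_def)

definition quat_i :: quat where "quat_i = Quat 0 1 0 0"
definition quat_j :: quat where "quat_j = Quat 0 0 1 0"
definition quat_k :: quat where "quat_k = Quat 0 0 0 1"

lemma quat_units_mult:
  "quat_i * quat_i = -1" "quat_j * quat_j = -1" "quat_k * quat_k = -1"
  "quat_i * quat_j = quat_k" "quat_j * quat_k = quat_i" "quat_k * quat_i = quat_j"
  "quat_j * quat_i = - quat_k" "quat_k * quat_j = - quat_i" "quat_i * quat_k = - quat_j"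
  by (simp_all add: quat_i_def quat_j_def quat_k_def quat_eq_iff)


section \<open>Slice regular functions\<close>

definition imag_units :: "quat set" where
  "imag_units = {q. q\<^sup>2 = -1}"

definition slice_plane :: "quat \<Rightarrow> quat set" where
  "slice_plane I = span {1, I}"

definition symmetric_slice_domain :: "quat set \<Rightarrow> bool" where
  "symmetric_slice_domain \<Omega> \<longleftrightarrow>
     open \<Omega> \<and> connected \<Omega> \<and> \<Omega> \<inter> \<real> \<noteq> {} \<and>
     (\<forall>\<alpha> \<beta>. \<forall>I\<in>imag_units. of_real \<alpha> + I * of_real \<beta> \<in> \<Omega> \<longrightarrow>
        (\<forall>J\<in>imag_units. of_real \<alpha> + J * of_real \<beta> \<in> \<Omega>))"

text \<open>Functions on \<open>\<Omega>\<close> are represented by total functions; their values outside \<open>\<Omega>\<close>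
  are irrelevant. Holomorphy of \<open>f\<^sub>J\<close> is real differentiability in \<open>(\<alpha>, \<beta>)\<close> together with
  the Cauchy-Riemann equation, where \<open>D (1, 0)\<close> and \<open>D (0, 1)\<close> are the partial derivatives
  with respect to \<open>\<alpha>\<close> and \<open>\<beta>\<close>.\<close>

definition slice_regular :: "quat set \<Rightarrow> (quat \<Rightarrow> quat) set" where
  "slice_regular \<Omega> =
     {f. \<forall>J\<in>imag_units. \<forall>\<alpha> \<beta>. of_real \<alpha> + J * of_real \<beta> \<in> \<Omega> \<longrightarrow>
        (\<exists>D. ((\<lambda>(a, b). f (of_real a + J * of_real b)) has_derivative D) (at (\<alpha>, \<beta>)) \<and>
             (1 / 2) *\<^sub>R (D (1, 0) + J * D (0, 1)) = 0)}"

definition slice_regular_preserving :: "quat set \<Rightarrow> quat \<Rightarrow> (quat \<Rightarrow> quat) set" where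
  "slice_regular_preserving \<Omega> J =
     {f \<in> slice_regular \<Omega>. f ` (\<Omega> \<inter> slice_plane J) \<subseteq> slice_plane J}"

definition slice_preserving :: "quat set \<Rightarrow> (quat \<Rightarrow> quat) set" where
  "slice_preserving \<Omega> =
     {f \<in> slice_regular \<Omega>. \<forall>I\<in>imag_units. f ` (\<Omega> \<inter> slice_plane I) \<subseteq> slice_plane I}"

text \<open>The description below determines the value at each \<open>q \<in> \<Omega>\<close> because on a symmetric slice
  domain every slice regular function has such a decomposition, unique on \<open>\<Omega>\<close>.\<close>

definition symmetrized :: "quat set \<Rightarrow> (quat \<Rightarrow> quat) \<Rightarrow> quat \<Rightarrow> quat" where
  "symmetrized \<Omega> f q =
     (THE w. \<exists>f0 \<in> slice_preserving \<Omega>. \<exists>f1 \<in> slice_preserving \<Omega>.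
             \<exists>f2 \<in> slice_preserving \<Omega>. \<exists>f3 \<in> slice_preserving \<Omega>.
        (\<forall>p\<in>\<Omega>. f p = f0 p + f1 p * quat_i + f2 p * quat_j + f3 p * quat_k) \<and>
        w = (f0 q)\<^sup>2 + (f1 q)\<^sup>2 + (f2 q)\<^sup>2 + (f3 q)\<^sup>2)"

text \<open>The order of \<open>\<mu>\<close> at a real point \<open>x \<in> \<Omega>\<close>, which is well defined when \<open>\<mu>\<close> is slice regular
  and does not vanish identically on the symmetric slice domain \<open>\<Omega>\<close>.\<close>

definition real_zero_order :: "quat set \<Rightarrow> (quat \<Rightarrow> quat) \<Rightarrow> real \<Rightarrow> nat" where
  "real_zero_order \<Omega> \<mu> x =
     (THE k. \<exists>\<nu> \<in> slice_regular \<Omega>.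
        (\<forall>q\<in>\<Omega>. \<mu> q = (q - of_real x) ^ k * \<nu> q) \<and> \<nu> (of_real x) \<noteq> 0)"

end

(* Identify each slice plane with the complex numbers and let D be the resulting plane domain,
   which is symmetric under conjugation. By the identity theorem, slice preserving functions
   correspond to holomorphic M on D with M (cnj z) = cnj (M z), functions preserving the slice
   of I0 correspond to arbitrary holomorphic H on D, and the symmetrized function corresponds
   to H(z) * cnj (H (cnj z)). This product is |H|^2 on the real axis, so it is nonnegative there,
   and nonnegativity alone forces real zeros to have even order.

   Conversely, if M is nonnegative on the real axis, take W whose zeros are those of M in the
   upper half-plane with full multiplicity and the real ones with half of it (Weierstrass on
   the open set D). Then M is W(z) * cnj (W (cnj z)) times a zero-free function, positive at
   some real point; since D is simply connected the latter is exp G with G real on the real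
   axis, and H = W * exp (G / 2). *)

theory Submission
  imports Defs "HOL-Complex_Analysis.Complex_Analysis"
begin

section \<open>Weierstrass products on open sets\<close>

text \<open>The order of \<open>H z * cnj (H (cnj z))\<close> at z is the order of H at z plus its
  order at \<open>cnj z\<close>. The zeros of a conjugate pair can be shared out freely, but a real
  zero is its own partner and is counted twice: this is the source of the parity condition. The
  zeros of M may accumulate at boundary points of D, so there need be no entire function with these
  zeros; the Weierstrass products are therefore built on the open set itself. The logarithm of the
  zero-free quotient is fixed only up to multiples of 2 pi i; positivity at one real point selects a
  branch that is real there, and reflection symmetry then holds on all of D. On the quaternionic
  side, each real point lies in every slice, and the identity theorem started from the real axis
  makes the same complex functions serve all slices. Finally, \<open>symmetrized\<close> refers to
  i, j, k whereas h refers to I0; expanding I0 in i, j, k introduces three real coefficients whose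
  squares sum to 1.\<close>

lemma
  fixes F :: "nat \<Rightarrow> complex \<Rightarrow> complex"
  assumes D: "open D" and holo: "\<And>n. F n holomorphic_on D"
    and bound: "\<And>C. compact C \<Longrightarrow> C \<subseteq> D \<Longrightarrow>
      \<exists>M. summable M \<and> (\<forall>\<^sub>F n in sequentially. \<forall>z\<in>C. norm (F n z - 1) \<le> M n)"
  shows convergent_prod_locally_bounded: "z \<in> D \<Longrightarrow> convergent_prod (\<lambda>n. F n z)"
    and holomorphic_on_prodinf: "(\<lambda>z. \<Prod>n. F n z) holomorphic_on D"
proof -
  show conv: "convergent_prod (\<lambda>n. F n z)" if z: "z \<in> D" for z
  proof -
    obtain M where M: "summable M" "\<forall>\<^sub>F n in sequentially. norm (F n z - 1) \<le> M n"
      using bound[of "{z}"] z by auto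
    have "summable (\<lambda>n. norm (F n z - 1))"
      by (rule summable_comparison_test_ev[OF _ M(1)]) (use M(2) in simp)
    then show ?thesis
      by (simp add: abs_convergent_prod_conv_summable abs_convergent_prod_imp_convergent_prod)
  qed
  show "(\<lambda>z. \<Prod>n. F n z) holomorphic_on D"
  proof (rule holomorphic_uniform_sequence[OF D])
    show "(\<lambda>z. \<Prod>n<N. F n z) holomorphic_on D" for N
      by (intro holomorphic_intros holo)
    fix z assume "z \<in> D"
    then obtain d where d: "d > 0" "cball z d \<subseteq> D"
      using D open_contains_cball by blast
    obtain M where M: "summable M"
        "\<forall>\<^sub>F n in sequentially. \<forall>w\<in>cball z d. norm (F n w - 1) \<le> M n"
      using bound[OF compact_cball d(2)] by auto
    have "uniformly_convergent_on (cball z d) (\<lambda>N w. \<Sum>n<N. norm (F n w - 1))"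
      by (rule Weierstrass_m_test'_ev[OF _ M(1)]) (use M(2) in simp)
    then have "uniformly_convergent_on (cball z d) (\<lambda>N w. \<Prod>n<N. F n w)"
      by (intro uniformly_convergent_on_prod' compact_cball
            continuous_on_subset[OF holomorphic_on_imp_continuous_on[OF holo] d(2)])
    then obtain g where g: "uniform_limit (cball z d) (\<lambda>N w. \<Prod>n<N. F n w) g sequentially"
      by (auto simp: uniformly_convergent_on_def)
    have "g w = (\<Prod>n. F n w)" if "w \<in> cball z d" for w
    proof -
      have "(\<lambda>N. \<Prod>n<N. F n w) \<longlonglongrightarrow> g w"
        using g that by (rule tendsto_uniform_limitI)
      moreover have "(\<lambda>N. \<Prod>n<N. F n w) \<longlonglongrightarrow> (\<Prod>n. F n w)"
        using conv[of w] that d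
        by (intro has_prod_imp_tendsto' convergent_prod_has_prod) auto
      ultimately show ?thesis using LIMSEQ_unique by blast
    qed
    then have "uniform_limit (cball z d) (\<lambda>N w. \<Prod>n<N. F n w) (\<lambda>w. \<Prod>n. F n w) sequentially"
      using g by (subst uniform_limit_cong'[OF refl, of _ _ g]) auto
    with d show "\<exists>d>0. cball z d \<subseteq> D \<and>
        uniform_limit (cball z d) (\<lambda>N w. \<Prod>n<N. F n w) (\<lambda>w. \<Prod>n. F n w) sequentially"
      by blast
  qed
qed

text \<open>Only finitely many factors can vanish at z. Stripping these of their linear parts leaves
  a convergent product of factors that are nonzero at z, and such a product is itself nonzero
  there.\<close>

lemma prodinf_zeros:
  fixes F G :: "nat \<Rightarrow> complex \<Rightarrow> complex" and a :: "nat \<Rightarrow> complex"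
  assumes D: "open D" and G: "\<And>n. G n holomorphic_on D" "\<And>n z. z \<in> D \<Longrightarrow> G n z \<noteq> 0"
    and F: "\<And>n z. z \<in> D \<Longrightarrow> F n z = (if n \<in> N then z - a n else 1) * G n z"
    and bound: "\<And>C. compact C \<Longrightarrow> C \<subseteq> D \<Longrightarrow>
      \<exists>M. summable M \<and> (\<forall>\<^sub>F n in sequentially. \<forall>z\<in>C. norm (F n z - 1) \<le> M n)"
    and z: "z \<in> D"
  shows "\<exists>W. W holomorphic_on D \<and> W z \<noteq> 0 \<and>
           (\<forall>w\<in>D. (\<Prod>n. F n w) = W w * (w - z) ^ card {n\<in>N. a n = z})"
proof -
  let ?T = "{n\<in>N. a n = z}"
  \<comment> \<open>A factor that vanishes at z has distance 1 from 1, which is excluded as soon as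
    \<open>M n < 1\<close>.\<close>
  have not_T: "\<forall>\<^sub>F n in sequentially. n \<notin> ?T"
  proof -
    obtain M where M: "summable M" "\<forall>\<^sub>F n in sequentially. norm (F n z - 1) \<le> M n"
      using bound[of "{z}"] z by auto
    have "\<forall>\<^sub>F n in sequentially. M n < 1"
      using summable_LIMSEQ_zero[OF M(1)] by (rule order_tendstoD) simp
    with M(2) show ?thesis
      by eventually_elim (use F[OF z] in auto)
  qed
  then have fin: "finite ?T"
    by (auto simp: eventually_sequentially intro: finite_subset[of _ "{..<k}" for k] not_le_imp_less)
  \<comment> \<open>Only finitely many factors change, so the eventual bound for F also serves
    H.\<close>
  define H where "H = (\<lambda>n. if n \<in> ?T then G n else F n)"
  have Fholo: "F n holomorphic_on D" for n
  proof -
    have "(\<lambda>z. (if n \<in> N then z - a n else 1) * G n z) holomorphic_on D"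
      by (cases "n \<in> N") (auto intro!: holomorphic_intros G)
    then show ?thesis using F by (simp cong: holomorphic_cong)
  qed
  have Hholo: "H n holomorphic_on D" for n
    by (simp add: H_def G Fholo)
  have Hbound: "\<exists>M. summable M \<and> (\<forall>\<^sub>F n in sequentially. \<forall>z\<in>C. norm (H n z - 1) \<le> M n)"
    if C: "compact C" "C \<subseteq> D" for C
  proof -
    obtain M where M: "summable M" "\<forall>\<^sub>F n in sequentially. \<forall>z\<in>C. norm (F n z - 1) \<le> M n"
      using bound[OF C] by auto
    have "\<forall>\<^sub>F n in sequentially. \<forall>z\<in>C. norm (H n z - 1) \<le> M n"
      using M(2) not_T by eventually_elim (auto simp: H_def)
    with M(1) show ?thesis by blast
  qed
  have conv: "convergent_prod (\<lambda>n. H n w)" if "w \<in> D" for w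
    by (rule convergent_prod_locally_bounded[OF D Hholo _ that]) (rule Hbound)
  have Pholo: "(\<lambda>w. \<Prod>n. H n w) holomorphic_on D"
    by (rule holomorphic_on_prodinf[OF D Hholo]) (rule Hbound)
  have "(\<Prod>n. H n z) \<noteq> 0"
    by (rule prodinf_nonzero[OF conv[OF z]]) (auto simp: H_def F[OF z] G(2)[OF z])
  moreover have "(\<Prod>n. F n w) = (\<Prod>n. H n w) * (w - z) ^ card ?T" if w: "w \<in> D" for w
  proof -
    let ?L = "\<lambda>n. if n \<in> ?T then w - z else 1"
    have "?L has_prod (\<Prod>n\<in>?T. ?L n)"
      by (rule has_prod_finite[OF fin]) auto
    then have L: "?L has_prod (w - z) ^ card ?T"
      by simp
    have "F n w = H n w * ?L n" for n
      using F[OF w] by (auto simp: H_def)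
    then have "(\<Prod>n. F n w) = (\<Prod>n. H n w * ?L n)" by simp
    also have "\<dots> = (\<Prod>n. H n w) * (\<Prod>n. ?L n)"
      using conv[OF w] has_prod_iff[THEN iffD1, OF L, THEN conjunct1] by (rule prodinf_mult[symmetric])
    also have "(\<Prod>n. ?L n) = (w - z) ^ card ?T"
      by (rule has_prod_unique[OF L, symmetric])
    finally show ?thesis .
  qed
  ultimately show "\<exists>W. W holomorphic_on D \<and> W z \<noteq> 0 \<and>
           (\<forall>w\<in>D. (\<Prod>n. F n w) = W w * (w - z) ^ card ?T)"
    using Pholo by blast
qed


text \<open>The inversion \<open>w = 1 / (z - p)\<close> turns the complement of \<open>D\<close> (together with infinity) into a
  compact set \<open>K\<close>. The \<open>n\<close>-th factor is the \<open>n\<close>-th elementary factor evaluated at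
  \<open>(\<alpha> - \<beta>) / (w - \<beta>)\<close>, where \<open>\<alpha>\<close> is the image of the zero \<open>a n\<close> and \<open>\<beta>\<close> the point of \<open>K\<close> nearest
  to it; clearing denominators makes it holomorphic at \<open>p\<close> as well.\<close>

lemma weierstrass_product_on_open:
  fixes a :: "nat \<Rightarrow> complex"
  assumes D: "open D" and p: "p \<in> D"
    and a: "\<And>n. n \<in> N \<Longrightarrow> a n \<in> D" "\<And>n. n \<in> N \<Longrightarrow> a n \<noteq> p"
    and fin: "\<And>C. compact C \<Longrightarrow> C \<subseteq> D \<Longrightarrow> finite {n\<in>N. a n \<in> C}"
  obtains W where "W holomorphic_on D"
    "\<And>z. z \<in> D \<Longrightarrow> \<exists>V. V holomorphic_on D \<and> V z \<noteq> 0 \<and>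
       (\<forall>w\<in>D. W w = V w * (w - z) ^ card {n\<in>N. a n = z})"
proof -
  \<comment> \<open>U is the image of D without p under the inversion. The point p goes to infinity,
    which makes K bounded; 0 is the image of infinity and always lies in K, so nearest points of K
    exist.\<close>
  define U where "U = {w. w \<noteq> 0 \<and> p + 1 / w \<in> D}"
  define K where "K = - U"
  have "open U"
  proof -
    have "open ((\<lambda>w. p + 1 / w) -` D \<inter> (- {0}))"
      by (subst Int_commute, rule continuous_open_preimage) (auto intro!: continuous_intros D)
    also have "(\<lambda>w. p + 1 / w) -` D \<inter> (- {0}) = U" by (auto simp: U_def)
    finally show ?thesis .
  qed
  obtain r where r: "r > 0" "cball p r \<subseteq> D"
    using D p open_contains_cball by blast
  have K_bound: "norm w \<le> 1 / r" if "w \<in> K" for w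
  proof (rule ccontr)
    assume w: "\<not> norm w \<le> 1 / r"
    then have "w \<noteq> 0" using r by auto
    moreover have "norm (1 / w) < r"
      using w r \<open>w \<noteq> 0\<close> by (simp add: norm_divide field_simps)
    then have "p + 1 / w \<in> cball p r" by (simp add: dist_norm)
    ultimately show False using that r by (auto simp: K_def U_def)
  qed
  have K: "compact K" "K \<noteq> {}"
  proof -
    show "compact K"
      using \<open>open U\<close> K_bound by (auto simp: compact_eq_bounded_closed bounded_iff K_def)
    show "K \<noteq> {}" by (auto simp: K_def U_def)
  qed
  define \<alpha> where "\<alpha> = (\<lambda>n. 1 / (a n - p))"
  define \<beta> where "\<beta> = (\<lambda>n. closest_point K (\<alpha> n))"
  have \<beta>: "\<beta> n \<in> K" for n
    unfolding \<beta>_def using K by (intro closest_point_in_set compact_imp_closed)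
  have \<alpha>0: "\<alpha> n \<noteq> 0" "a n = p + 1 / \<alpha> n" if "n \<in> N" for n
    using a[OF that] by (auto simp: \<alpha>_def)
  \<comment> \<open>The images of the zeros can accumulate only at K: a zero whose image is at least
    \<epsilon> away from K lies either in the disc around p or in the image of the compact set
    \<open>?C\<close>, and both are compact subsets of D.\<close>
  have close: "finite {n\<in>N. \<epsilon> \<le> norm (\<alpha> n - \<beta> n)}" if \<epsilon>: "\<epsilon> > 0" for \<epsilon>
  proof (rule finite_subset)
    let ?C = "cball 0 (1 / r) \<inter> {w. \<epsilon> \<le> infdist w K}"
    have C: "?C \<subseteq> U"
    proof
      fix w assume "w \<in> ?C"
      then have "w \<notin> K" using \<epsilon> by auto
      then show "w \<in> U" by (simp add: K_def)
    qed
    have "compact ?C"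
      by (intro compact_Int_closed compact_cball closed_Collect_le continuous_intros)
    then have "compact ((\<lambda>w. p + 1 / w) ` ?C)"
      using C by (intro compact_continuous_image continuous_intros) (auto simp: U_def)
    then show "finite ({n\<in>N. a n \<in> cball p r} \<union> {n\<in>N. a n \<in> (\<lambda>w. p + 1 / w) ` ?C})"
      using r C by (intro finite_UnI fin) (auto simp: U_def)
    show "{n\<in>N. \<epsilon> \<le> norm (\<alpha> n - \<beta> n)} \<subseteq>
        {n\<in>N. a n \<in> cball p r} \<union> {n\<in>N. a n \<in> (\<lambda>w. p + 1 / w) ` ?C}"
    proof safe
      fix n assume n: "n \<in> N" "\<epsilon> \<le> norm (\<alpha> n - \<beta> n)" "a n \<notin> (\<lambda>w. p + 1 / w) ` ?C"
      have "infdist (\<alpha> n) K = dist (\<alpha> n) (\<beta> n)"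
        unfolding \<beta>_def using K
        by (metis closest_point_in_set closest_point_le compact_imp_closed infdist_le
              infdist_attains_inf order_antisym)
      then have "\<epsilon> \<le> infdist (\<alpha> n) K" using n by (simp add: dist_norm)
      moreover have "\<alpha> n \<notin> ?C" using n \<alpha>0(2)[of n] by blast
      ultimately have "norm (\<alpha> n) > 1 / r" by auto
      then have "norm (a n - p) < r"
        using r a(2)[OF n(1)] by (simp add: \<alpha>_def norm_divide field_simps)
      then show "a n \<in> cball p r" by (simp add: dist_norm norm_minus_commute)
    qed
  qed
  have denom: "1 - b * (z - p) \<noteq> 0" if "z \<in> D" "b \<in> K" for z b
  proof
    assume eq: "1 - b * (z - p) = 0"
    then have "b \<noteq> 0" by auto
    moreover have "p + 1 / b = z" using eq \<open>b \<noteq> 0\<close> by (simp add: field_simps)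
    ultimately show False using that by (simp add: K_def U_def)
  qed
  define u where "u = (\<lambda>n z. (z - p) * (\<alpha> n - \<beta> n) / (1 - \<beta> n * (z - p)))"
  define F where "F = (\<lambda>n z. if n \<in> N then weierstrass_factor n (u n z) else 1)"
  \<comment> \<open>\<open>G n\<close> is what remains of the elementary factor after splitting off
    \<open>z - a n\<close>, using 1 - u = (z - a)(-\<alpha>) / (1 - \<beta>(z - p)). It has no zeros
    on D.\<close>
  define G where "G = (\<lambda>n z. if n \<in> N then - \<alpha> n / (1 - \<beta> n * (z - p)) *
                                exp (\<Sum>k=1..n. u n z ^ k / of_nat k) else 1)"
  have Gholo: "G n holomorphic_on D" for n
    using denom[OF _ \<beta>] by (cases "n \<in> N") (auto simp: G_def u_def intro!: holomorphic_intros)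
  have G0: "G n z \<noteq> 0" if "z \<in> D" for n z
    using denom[OF that \<beta>] \<alpha>0 by (simp add: G_def)
  have FG: "F n z = (if n \<in> N then z - a n else 1) * G n z" if "z \<in> D" for n z
  proof (cases "n \<in> N")
    case True
    have "1 - u n z = (1 - \<alpha> n * (z - p)) / (1 - \<beta> n * (z - p))"
      using denom[OF that \<beta>, of n] by (simp add: u_def field_simps)
    also have "1 - \<alpha> n * (z - p) = (z - a n) * (- \<alpha> n)"
      using a(2)[OF True] by (simp add: \<alpha>_def field_simps)
    finally show ?thesis
      using True by (simp add: F_def G_def weierstrass_factor_def)
  qed (simp add: F_def G_def)
  have bound: "\<exists>M. summable M \<and> (\<forall>\<^sub>F n in sequentially. \<forall>z\<in>C. norm (F n z - 1) \<le> M n)"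
    if C: "compact C" "C \<subseteq> D" for C
  proof -
    \<comment> \<open>This is the part of u that depends on z, with \<beta> ranging over all of K;
      its denominator has no zero on the compact set \<open>C \<times> K\<close>, so it is bounded
      uniformly in n.\<close>
    let ?q = "\<lambda>(z, b). (z - p) / (1 - b * (z - p))"
    have "compact (?q ` (C \<times> K))"
      using denom C K
      by (intro compact_continuous_image compact_Times)
         (auto simp: case_prod_unfold intro!: continuous_intros)
    then have "bounded (?q ` (C \<times> K))" by (rule compact_imp_bounded)
    then obtain B where B: "B > 0" "\<forall>x \<in> ?q ` (C \<times> K). norm x \<le> B"
      unfolding bounded_pos by blast
    \<comment> \<open>The threshold gives \<open>norm (u n z) \<le> 1 / 2\<close> for all but
      finitely many n. Since the degree of the elementary factor grows with n, its distance from 1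
      is then dominated by a geometric series.\<close>
    have "finite {n\<in>N. 1 / (2 * B) \<le> norm (\<alpha> n - \<beta> n)}"
      using B by (intro close) auto
    then have ev: "\<forall>\<^sub>F n in sequentially. n \<notin> {n\<in>N. 1 / (2 * B) \<le> norm (\<alpha> n - \<beta> n)}"
      by (simp add: eventually_cofinite flip: cofinite_eq_sequentially)
    have "\<forall>\<^sub>F n in sequentially. \<forall>z\<in>C. norm (F n z - 1) \<le> 3 * (1 / 2) ^ Suc n"
      using ev
    proof eventually_elim
      case (elim n)
      show ?case
      proof
        fix z assume z: "z \<in> C"
        show "norm (F n z - 1) \<le> 3 * (1 / 2) ^ Suc n"
        proof (cases "n \<in> N")
          case True
          have "norm (u n z) = norm (?q (z, \<beta> n)) * norm (\<alpha> n - \<beta> n)"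
            by (simp add: u_def norm_mult norm_divide)
          also have "\<dots> \<le> B * (1 / (2 * B))"
          proof (rule mult_mono)
            show "norm (?q (z, \<beta> n)) \<le> B"
              using z \<beta>[of n] by (intro B(2)[rule_format] imageI) auto
            show "norm (\<alpha> n - \<beta> n) \<le> 1 / (2 * B)" using elim True by auto
          qed (use B(1) in auto)
          also have "\<dots> = 1 / 2" using B by simp
          finally have half: "norm (u n z) \<le> 1 / 2" .
          have "norm (F n z - 1) \<le> 3 * norm (u n z) ^ Suc n"
            using weierstrass_factor_bound[OF half, of n] True by (simp add: F_def)
          also have "\<dots> \<le> 3 * (1 / 2) ^ Suc n"
            using half by (intro mult_left_mono power_mono) auto
          finally show ?thesis .
        qed (simp add: F_def)
      qed
    qed
    moreover have "summable (\<lambda>n. 3 * (1 / 2) ^ Suc n :: real)"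
      by (intro summable_mult) (simp add: summable_geometric summable_Suc_iff del: power_Suc)
    ultimately show ?thesis by blast
  qed
  have Fholo: "F n holomorphic_on D" for n
    using denom[OF _ \<beta>] unfolding F_def u_def
    by (cases "n \<in> N") (auto intro!: holomorphic_intros)
  show thesis
  proof (rule that)
    show "(\<lambda>z. \<Prod>n. F n z) holomorphic_on D"
      by (rule holomorphic_on_prodinf[OF D Fholo]) (rule bound)
    fix z assume "z \<in> D"
    show "\<exists>V. V holomorphic_on D \<and> V z \<noteq> 0 \<and>
        (\<forall>w\<in>D. (\<Prod>n. F n w) = V w * (w - z) ^ card {n\<in>N. a n = z})"
      by (rule prodinf_zeros[OF D Gholo G0 FG _ \<open>z \<in> D\<close>]) (assumption | rule bound)+
  qed
qed

text \<open>The zeros are enumerated with repetition, each z exactly \<open>e z\<close> times.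
  Indexing by a subset of the naturals covers finite and infinite zero sets alike.\<close>

theorem holomorphic_with_prescribed_zeros:
  fixes e :: "complex \<Rightarrow> nat"
  assumes D: "open D" "D \<noteq> {}"
    and fin: "\<And>C. compact C \<Longrightarrow> C \<subseteq> D \<Longrightarrow> finite {z\<in>C. e z \<noteq> 0}"
  obtains W where "W holomorphic_on D"
    "\<And>z. z \<in> D \<Longrightarrow> \<exists>V. V holomorphic_on D \<and> V z \<noteq> 0 \<and> (\<forall>w\<in>D. W w = V w * (w - z) ^ e z)"
proof -
  \<comment> \<open>The centre of the inversion must not be a prescribed zero. A closed disc in D is
    infinite but contains only finitely many of them.\<close>
  obtain p where p: "p \<in> D" "e p = 0"
  proof -
    from D obtain z r where zr: "r > 0" "cball z r \<subseteq> D"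
      using open_contains_cball by blast
    have "infinite (cball z r)"
      using zr uncountable_cball countable_finite by blast
    then have "infinite (cball z r - {w\<in>cball z r. e w \<noteq> 0})"
      using fin[OF compact_cball zr(2)] by simp
    then have "cball z r - {w\<in>cball z r. e w \<noteq> 0} \<noteq> {}"
      by (metis finite.emptyI)
    with zr that show thesis by auto
  qed
  \<comment> \<open>The second component only tells the copies of a zero apart; the first is the
    zero itself.\<close>
  define S where "S = (SIGMA z:{z\<in>D. e z \<noteq> 0}. {..<e z})"
  have "countable {z\<in>D. e z \<noteq> 0}"
  proof -
    obtain C :: "nat \<Rightarrow> complex set" where
      C: "\<And>n. compact (C n)" "\<And>n. C n \<subseteq> D" "\<Union> (range C) = D"
      using open_Union_compact_subsets[OF D(1)] by metis
    have "countable (\<Union>n. {z\<in>C n. e z \<noteq> 0})"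
      using fin[OF C(1,2)] by (intro countable_UN) (auto intro: countable_finite)
    moreover have "{z\<in>D. e z \<noteq> 0} = (\<Union>n. {z\<in>C n. e z \<noteq> 0})"
      using C(3) by auto
    ultimately show ?thesis by simp
  qed
  then have S: "countable S" unfolding S_def by (intro countable_SIGMA) auto
  define a where "a = (\<lambda>n. fst (from_nat_into S n))"
  let ?N = "to_nat_on S ` S"
  have a_eq: "a (to_nat_on S s) = fst s" if "s \<in> S" for s
    using that S by (simp add: a_def)
  have card: "card {n\<in>?N. a n = z} = e z" if "z \<in> D" for z
  proof -
    have "{n\<in>?N. a n = z} = to_nat_on S ` ({z} \<times> {..<e z})"
      using a_eq that by (force simp: S_def)
    also have "card \<dots> = card ({z} \<times> {..<e z})"
      using that by (intro card_image inj_on_subset[OF inj_on_to_nat_on[OF S]]) (auto simp: S_def)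
    finally show ?thesis by (simp add: card_cartesian_product)
  qed
  have "finite {n\<in>?N. a n \<in> C}" if C: "compact C" "C \<subseteq> D" for C
  proof -
    have "{n\<in>?N. a n \<in> C} \<subseteq> to_nat_on S ` (SIGMA z:{z\<in>C. e z \<noteq> 0}. {..<e z})"
      using a_eq by (force simp: S_def)
    moreover have "finite (SIGMA z:{z\<in>C. e z \<noteq> 0}. {..<e z})"
      by (intro finite_SigmaI fin[OF C]) auto
    ultimately show ?thesis by (meson finite_imageI finite_subset)
  qed
  moreover have "a n \<in> D" "a n \<noteq> p" if "n \<in> ?N" for n
    using that a_eq p by (auto simp: S_def)
  ultimately obtain W where "W holomorphic_on D"
    "\<And>z. z \<in> D \<Longrightarrow> \<exists>V. V holomorphic_on D \<and> V z \<noteq> 0 \<and>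
       (\<forall>w\<in>D. W w = V w * (w - z) ^ card {n\<in>?N. a n = z})"
    using weierstrass_product_on_open[OF D(1) p(1), of ?N a] by blast
  with card that show thesis by simp
qed

section \<open>Domains symmetric under conjugation\<close>

lemma holomorphic_on_cnj_cnj:
  assumes "f holomorphic_on D" "open D" "\<And>z. z \<in> D \<Longrightarrow> cnj z \<in> D"
  shows "(\<lambda>z. cnj (f (cnj z))) holomorphic_on D"
proof -
  have "cnj ` D = D"
    using assms(3) by (metis complex_cnj_cnj image_subsetI subsetI subset_antisym image_eqI)
  with holomorphic_on_compose_cnj_cnj[of f D] assms show ?thesis
    by (simp add: o_def)
qed

text \<open>\<open>zor_poly\<close> provides the cofactor only near z. Away from z the quotient of M
  by the power is holomorphic, and the two agree where both are defined, so they glue to a cofactor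
  on all of D.\<close>

lemma holomorphic_zero_factor:
  assumes M: "M holomorphic_on D" and D: "open D" "connected D" "z \<in> D" "\<exists>w\<in>D. M w \<noteq> 0"
  obtains N where "N holomorphic_on D" "N z \<noteq> 0"
    "\<And>w. w \<in> D \<Longrightarrow> M w = N w * (w - z) ^ nat (zorder M z)"
proof -
  define k where "k = nat (zorder M z)"
  define g where "g = zor_poly M z"
  obtain r where r: "r > 0" "cball z r \<subseteq> D" "g holomorphic_on cball z r"
    "\<And>w. w \<in> cball z r \<Longrightarrow> M w = g w * (w - z) ^ k \<and> g w \<noteq> 0"
    using zorder_exist_zero[OF M D] unfolding k_def g_def by blast
  define N where "N = (\<lambda>w. if w = z then g z else M w / (w - z) ^ k)"
  have "N w = g w" if "w \<in> ball z r" for w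
    using r(4)[of w] that by (auto simp: N_def)
  then have "N holomorphic_on ball z r"
    using holomorphic_transform[OF holomorphic_on_subset[OF r(3) ball_subset_cball]] by metis
  moreover have "N holomorphic_on D - {z}"
  proof -
    have "(\<lambda>w. M w / (w - z) ^ k) holomorphic_on D - {z}"
      by (intro holomorphic_intros holomorphic_on_subset[OF M]) auto
    then show ?thesis by (rule holomorphic_transform) (simp add: N_def)
  qed
  ultimately have "N holomorphic_on ball z r \<union> (D - {z})"
    using D by (intro holomorphic_on_Un open_delete) auto
  moreover have "ball z r \<union> (D - {z}) = D"
    using r(1,2) D(3) by auto
  ultimately have "N holomorphic_on D" by simp
  moreover have "N z \<noteq> 0" using r by (simp add: N_def)
  moreover have "M w = N w * (w - z) ^ k" if "w \<in> D" for w
    using r(4)[of z] r(1) by (cases "w = z") (auto simp: N_def)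
  ultimately show thesis using that unfolding k_def by blast
qed

text \<open>Near x the factor f keeps the sign of \<open>f x\<close>, while an odd power of
  \<open>t - x\<close> changes sign. The product is negative to the left of x if
  \<open>f x > 0\<close>, and to the right if \<open>f x < 0\<close>.\<close>

lemma even_if_power_nonneg:
  fixes f :: "real \<Rightarrow> real"
  assumes "isCont f x" "f x \<noteq> 0" "\<forall>\<^sub>F t in at x. 0 \<le> f t * (t - x) ^ k"
  shows "even k"
proof (rule ccontr)
  assume k: "odd k"
  have lim: "(f \<longlongrightarrow> f x) (at x)" using assms(1) by (simp add: isCont_def)
  show False
  proof (cases "f x > 0")
    case True
    have "\<forall>\<^sub>F t in at_left x. 0 < f t"
      using order_tendstoD(1)[OF lim True] by (rule eventually_at_split[THEN iffD1, THEN conjunct1])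
    moreover have "\<forall>\<^sub>F t in at_left x. 0 \<le> f t * (t - x) ^ k"
      using assms(3) by (rule eventually_at_split[THEN iffD1, THEN conjunct1])
    moreover have "\<forall>\<^sub>F t in at_left x. t < x"
      by (simp add: eventually_at_filter)
    ultimately have "\<forall>\<^sub>F t in at_left x. False"
    proof eventually_elim
      case (elim t)
      then have "(t - x) ^ k < 0" using k by (simp add: power_less_zero_eq)
      with elim show False by (simp add: zero_le_mult_iff)
    qed
    then show False by simp
  next
    case False
    then have "f x < 0" using assms(2) by simp
    have "\<forall>\<^sub>F t in at_right x. 0 > f t"
      using order_tendstoD(2)[OF lim \<open>f x < 0\<close>]
      by (rule eventually_at_split[THEN iffD1, THEN conjunct2])
    moreover have "\<forall>\<^sub>F t in at_right x. 0 \<le> f t * (t - x) ^ k"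
      using assms(3) by (rule eventually_at_split[THEN iffD1, THEN conjunct2])
    moreover have "\<forall>\<^sub>F t in at_right x. t > x"
      by (simp add: eventually_at_filter)
    ultimately have "\<forall>\<^sub>F t in at_right x. False"
    proof eventually_elim
      case (elim t)
      then have "(t - x) ^ k > 0" by simp
      with elim show False by (simp add: zero_le_mult_iff)
    qed
    then show False by simp
  qed
qed

section \<open>Reflection-symmetric holomorphic functions and the orders of their zeros\<close>

locale symmetric_domain =
  fixes D :: "complex set"
  assumes open_D: "open D" and connected_D: "connected D"
    and cnj_D: "z \<in> D \<Longrightarrow> cnj z \<in> D"
    and real_D: "\<exists>x. complex_of_real x \<in> D"
begin

definition real_on :: "(complex \<Rightarrow> complex) \<Rightarrow> bool" where
  "real_on F \<longleftrightarrow> F holomorphic_on D \<and> (\<forall>z\<in>D. F (cnj z) = cnj (F z))"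

lemma real_onD:
  assumes "real_on F"
  shows "F holomorphic_on D" "z \<in> D \<Longrightarrow> F (cnj z) = cnj (F z)"
  using assms by (auto simp: real_on_def)

lemma real_on_real:
  assumes "real_on F" "complex_of_real x \<in> D"
  shows "Im (F (of_real x)) = 0" "F (of_real x) = of_real (Re (F (of_real x)))"
proof -
  have "F (of_real x) = cnj (F (of_real x))"
    using real_onD(2)[OF assms] by simp
  then show "Im (F (of_real x)) = 0"
    by (metis Reals_cnj_iff complex_is_Real_iff)
  then show "F (of_real x) = of_real (Re (F (of_real x)))"
    by (simp add: complex_eq_iff)
qed

lemma eventually_of_real_in:
  assumes "complex_of_real x \<in> D"
  shows "\<forall>\<^sub>F t in at x. complex_of_real t \<in> D"
proof -
  have "open (complex_of_real -` D)"
    by (intro open_vimage open_D continuous_intros)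
  with assms show ?thesis
    using eventually_at_in_open'[of "complex_of_real -` D" x] by simp
qed

text \<open>D is open and meets the real axis, so its real points accumulate inside D and the
  identity theorem applies. This carries facts from the real axis to whole slices.\<close>

lemma real_points_determine:
  assumes "f holomorphic_on D" "g holomorphic_on D"
    and "\<And>x. complex_of_real x \<in> D \<Longrightarrow> f (of_real x) = g (of_real x)" "z \<in> D"
  shows "f z = g z"
proof -
  obtain x where x: "complex_of_real x \<in> D" using real_D by blast
  have "complex_of_real x islimpt {z \<in> D. z \<in> \<real>}"
  proof -
    have "((\<lambda>t. complex_of_real t) \<longlongrightarrow> of_real x) (at x)"
      by (intro tendsto_intros)
    then have "filterlim complex_of_real (at (of_real x)) (at x)"
      by (auto simp: filterlim_at eventually_at_filter)
    moreover have "\<exists>\<^sub>F t in at x. complex_of_real t \<in> {z \<in> D. z \<in> \<real>}"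
      using eventually_of_real_in[OF x]
      by (intro eventually_frequently) (auto elim: eventually_mono)
    ultimately have "\<exists>\<^sub>F z in at (of_real x). z \<in> {z \<in> D. z \<in> \<real>}"
      unfolding frequently_def filterlim_iff by blast
    then show ?thesis by (simp add: islimpt_conv_frequently_at)
  qed
  have "f z - g z = 0"
    by (rule analytic_continuation[OF _ open_D connected_D _ x \<open>_ islimpt _\<close> _ \<open>z \<in> D\<close>])
       (use assms in \<open>auto intro!: holomorphic_intros elim!: Reals_cases\<close>)
  then show ?thesis by simp
qed

text \<open>For real x the power of \<open>w - of_real x\<close> is itself symmetric and cancels
  away from x, so the cofactor is symmetric there; analytic continuation adds the point x.\<close>

lemma real_on_zero_factor:
  assumes M: "real_on M" "\<exists>w\<in>D. M w \<noteq> 0" and x: "complex_of_real x \<in> D"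
  obtains N where "real_on N" "N (of_real x) \<noteq> 0"
    "\<And>w. w \<in> D \<Longrightarrow> M w = N w * (w - of_real x) ^ nat (zorder M (of_real x))"
proof -
  define k where "k = nat (zorder M (of_real x))"
  obtain N where N: "N holomorphic_on D" "N (of_real x) \<noteq> 0"
    "\<And>w. w \<in> D \<Longrightarrow> M w = N w * (w - of_real x) ^ k"
    using holomorphic_zero_factor[OF real_onD(1)[OF M(1)] open_D connected_D x M(2)]
    unfolding k_def by blast
  have N': "(\<lambda>z. cnj (N (cnj z))) holomorphic_on D"
    by (rule holomorphic_on_cnj_cnj[OF N(1) open_D cnj_D])
  have "D - {of_real x} \<noteq> {}"
    using open_D x by (metis Diff_eq_empty_iff not_open_singleton subset_singletonD empty_iff)
  moreover have "N w = cnj (N (cnj w))" if "w \<in> D - {of_real x}" for w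
  proof -
    have "N (cnj w) * (cnj w - of_real x) ^ k = M (cnj w)"
      using N(3)[OF cnj_D] that by simp
    also have "\<dots> = cnj (N w * (w - of_real x) ^ k)"
      using N(3)[of w] real_onD(2)[OF M(1)] that by simp
    finally have "N (cnj w) * (cnj w - of_real x) ^ k = cnj (N w * (w - of_real x) ^ k)" .
    then have "cnj (N (cnj w) * (cnj w - of_real x) ^ k) = N w * (w - of_real x) ^ k"
      by (metis complex_cnj_cnj)
    with that show ?thesis by simp
  qed
  ultimately have "N w = cnj (N (cnj w))" if "w \<in> D" for w
    using analytic_continuation_open[OF _ open_D _ connected_D _ N(1) N', of "D - {of_real x}"]
      open_D that by blast
  then have "real_on N"
    using N(1) by (auto simp: real_on_def)
  with N(2,3) that show thesis unfolding k_def by blast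
qed

lemma even_zorder_real:
  assumes N: "real_on N" "N (of_real x) \<noteq> 0" and x: "complex_of_real x \<in> D"
    and M: "\<And>w. w \<in> D \<Longrightarrow> M w = N w * (w - of_real x) ^ k"
    and nonneg: "\<And>t. complex_of_real t \<in> D \<Longrightarrow> 0 \<le> Re (M (of_real t))"
  shows "even k"
proof (rule even_if_power_nonneg)
  show "isCont (\<lambda>t. Re (N (of_real t))) x"
  proof -
    have "isCont N (of_real x)"
      using real_onD(1)[OF N(1)] open_D x
      by (meson continuous_on_eq_continuous_at holomorphic_on_imp_continuous_on)
    then have "isCont (\<lambda>t. N (of_real t)) x"
      by (rule isCont_o2[where g = N, rotated]) (rule isCont_of_real, rule continuous_ident)
    then show ?thesis by (rule isCont_Re)
  qed
  show "Re (N (of_real x)) \<noteq> 0"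
    using real_on_real[OF N(1) x] N(2) by auto
  show "\<forall>\<^sub>F t in at x. 0 \<le> Re (N (of_real t)) * (t - x) ^ k"
    using eventually_of_real_in[OF x]
  proof eventually_elim
    case (elim t)
    have "M (of_real t) = of_real (Re (N (of_real t))) * of_real ((t - x) ^ k)"
      using M[OF elim] real_on_real(2)[OF N(1) elim] by simp
    then have "Re (M (of_real t)) = Re (N (of_real t)) * (t - x) ^ k"
      by (metis Re_complex_of_real of_real_mult)
    with nonneg[OF elim] show ?case by simp
  qed
qed

text \<open>Conjugating a zero factorization at z turns it into one at \<open>cnj z\<close> with the
  same exponent.\<close>

lemma zorder_cnj:
  assumes M: "real_on M" "\<exists>w\<in>D. M w \<noteq> 0" and z: "z \<in> D"
  shows "zorder M (cnj z) = zorder M z"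
proof -
  have pos: "zorder M z \<ge> 0"
    using zorder_exist_zero[OF real_onD(1)[OF M(1)] open_D connected_D z M(2)]
    by (auto split: if_splits)
  obtain N where N: "N holomorphic_on D" "N z \<noteq> 0"
    "\<And>w. w \<in> D \<Longrightarrow> M w = N w * (w - z) ^ nat (zorder M z)"
    using holomorphic_zero_factor[OF real_onD(1)[OF M(1)] open_D connected_D z M(2)] by blast
  show ?thesis
  proof (rule zorder_eqI[OF open_D cnj_D[OF z] holomorphic_on_cnj_cnj[OF N(1) open_D cnj_D]])
    fix w assume w: "w \<in> D" "w \<noteq> cnj z"
    have "M w = cnj (M (cnj w))" using real_onD(2)[OF M(1) w(1)] by simp
    also have "\<dots> = cnj (N (cnj w)) * (w - cnj z) ^ nat (zorder M z)"
      using N(3)[OF cnj_D[OF w(1)]] by simp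
    also have "\<dots> = cnj (N (cnj w)) * (w - cnj z) powi zorder M z"
      using pos by (simp add: power_int_def)
    finally show "M w = cnj (N (cnj w)) * (w - cnj z) powi zorder M z" .
  qed (use N in auto)
qed

text \<open>Zeros are matched first by a Weierstrass function W; the remaining zero-free factor is a
  symmetric exponential and is split by halving its exponent.\<close>

theorem norm_factorization:
  assumes D: "simply_connected D"
    and M: "real_on M" "\<exists>w\<in>D. M w \<noteq> 0"
    and nonneg: "\<And>t. complex_of_real t \<in> D \<Longrightarrow> 0 \<le> Re (M (of_real t))"
  obtains H where "H holomorphic_on D" "\<And>z. z \<in> D \<Longrightarrow> H z * cnj (H (cnj z)) = M z"
proof -
  note Mholo = real_onD(1)[OF M(1)]
  note Msym = real_onD(2)[OF M(1)]
  define m where "m = (\<lambda>z. nat (zorder M z))"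
  have m: "zorder M z = int (m z)" "M z = 0 \<longleftrightarrow> m z \<noteq> 0" if "z \<in> D" for z
    using zorder_exist_zero[OF Mholo open_D connected_D that M(2)]
    by (auto simp: m_def split: if_splits)
  \<comment> \<open>The aim is \<open>e z + e (cnj z) = m z\<close>. Giving a conjugate pair
    entirely to its upper member is one choice; on the real axis the halves are forced.\<close>
  define e where "e = (\<lambda>z. if Im z > 0 then m z else if Im z = 0 then m z div 2 else 0)"
  have "finite {z\<in>C. e z \<noteq> 0}" if C: "compact C" "C \<subseteq> D" for C
  proof -
    have "{z\<in>C. e z \<noteq> 0} \<subseteq> {z\<in>C. M z = 0}"
      using m C by (auto simp: e_def split: if_splits)
    moreover have "finite {z\<in>C. M z = 0}"
    proof (cases "M constant_on D")
      case True
      then have "{z\<in>C. M z = 0} = {}" using M(2) C by (force simp: constant_on_def)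
      then show ?thesis by (metis finite.emptyI)
    qed (rule holomorphic_compact_finite_zeros[OF Mholo open_D connected_D C])
    ultimately show ?thesis by (rule finite_subset)
  qed
  moreover have "D \<noteq> {}" using real_D by blast
  ultimately obtain W where W: "W holomorphic_on D"
    "\<And>z. z \<in> D \<Longrightarrow> \<exists>V. V holomorphic_on D \<and> V z \<noteq> 0 \<and> (\<forall>w\<in>D. W w = V w * (w - z) ^ e z)"
    using holomorphic_with_prescribed_zeros[OF open_D, of e] by blast
  \<comment> \<open>Off the axis exactly one of z and \<open>cnj z\<close> contributes. On it the
    sum is twice \<open>m z div 2\<close>, which equals \<open>m z\<close> only because
    nonnegativity makes \<open>m z\<close> even.\<close>
  have e_sum: "e z + e (cnj z) = m z" if z: "z \<in> D" for z
  proof (cases "Im z = 0")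
    case True
    then have zx: "complex_of_real (Re z) = z" by (simp add: complex_eq_iff)
    then have x: "complex_of_real (Re z) \<in> D" using z by simp
    obtain N where "real_on N" "N (of_real (Re z)) \<noteq> 0"
      "\<And>w. w \<in> D \<Longrightarrow> M w = N w * (w - of_real (Re z)) ^ nat (zorder M (of_real (Re z)))"
      using real_on_zero_factor[OF M x] by blast
    then have "even (nat (zorder M (of_real (Re z))))"
      using even_zorder_real x nonneg by blast
    then have "even (m z)" by (simp add: m_def zx)
    moreover have "cnj z = z" using True by (simp add: complex_eq_iff)
    then have "e z + e (cnj z) = 2 * (m z div 2)" using True by (simp add: e_def)
    ultimately show ?thesis by simp
  next
    case False
    then show ?thesis using zorder_cnj[OF M z] by (auto simp: e_def m_def)
  qed
  define P where "P = (\<lambda>z. W z * cnj (W (cnj z)))"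
  have Pholo: "P holomorphic_on D"
    unfolding P_def by (intro holomorphic_intros W holomorphic_on_cnj_cnj open_D cnj_D)
  have P: "\<exists>V. V holomorphic_on D \<and> V z \<noteq> 0 \<and> (\<forall>w\<in>D. P w = V w * (w - z) ^ m z)"
    if z: "z \<in> D" for z
  proof -
    obtain V where V: "V holomorphic_on D" "V z \<noteq> 0" "\<And>w. w \<in> D \<Longrightarrow> W w = V w * (w - z) ^ e z"
      using W(2)[OF z] by blast
    obtain V' where V': "V' holomorphic_on D" "V' (cnj z) \<noteq> 0"
      "\<And>w. w \<in> D \<Longrightarrow> W w = V' w * (w - cnj z) ^ e (cnj z)"
      using W(2)[OF cnj_D[OF z]] by blast
    have "P w = (V w * cnj (V' (cnj w))) * (w - z) ^ m z" if "w \<in> D" for w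
      using V(3)[OF that] V'(3)[OF cnj_D[OF that]]
      by (simp add: P_def e_sum[OF z, symmetric] power_add)
    moreover have "(\<lambda>w. V w * cnj (V' (cnj w))) holomorphic_on D"
      by (intro holomorphic_intros V V' holomorphic_on_cnj_cnj open_D cnj_D)
    moreover have "V z * cnj (V' (cnj z)) \<noteq> 0" using V V' by simp
    ultimately show ?thesis by blast
  qed
  have Pzero: "P z = 0 \<longleftrightarrow> M z = 0" if "z \<in> D" for z
    using P[OF that] m(2)[OF that] that by auto
  have Pord: "zorder P z = zorder M z" if z: "z \<in> D" for z
  proof -
    obtain V where "V holomorphic_on D" "V z \<noteq> 0" "\<forall>w\<in>D. P w = V w * (w - z) ^ m z"
      using P[OF z] by blast
    then have "zorder P z = int (m z)"
      by (intro zorder_eqI[OF open_D z]) auto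
    with m(1)[OF z] show ?thesis by simp
  qed
  \<comment> \<open>M and P have the same zeros with the same orders, so their quotient extends to a
    zero-free holomorphic function.\<close>
  obtain h where h: "h holomorphic_on D" "\<And>z. z \<in> D \<Longrightarrow> h z \<noteq> 0"
    "\<And>z. z \<in> D \<Longrightarrow> M z = h z * P z"
    using holomorphic_zorder_factorization[OF Mholo open_D connected_D Pholo Pzero]
      Pord by metis
  \<comment> \<open>M and P are both symmetric, so off the zeros of M the factor P cancels from the
    conjugated identity.\<close>
  have h_sym: "cnj (h (cnj z)) = h z" if "z \<in> D" for z
  proof (rule analytic_continuation_open[OF _ open_D _ connected_D _ _ h(1) _ that])
    let ?S = "D \<inter> M -` (- {0})"
    show "open ?S"
      by (rule continuous_open_preimage[OF holomorphic_on_imp_continuous_on[OF Mholo] open_D]) auto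
    show "?S \<noteq> {}" "?S \<subseteq> D" using M(2) by auto
    show "(\<lambda>z. cnj (h (cnj z))) holomorphic_on D"
      by (rule holomorphic_on_cnj_cnj[OF h(1) open_D cnj_D])
    fix z assume z: "z \<in> ?S"
    have "P (cnj z) = cnj (P z)" by (simp add: P_def)
    then have "cnj (h (cnj z)) * P z = cnj (M (cnj z))"
      using h(3)[OF cnj_D, of z] z by simp
    also have "\<dots> = h z * P z" using Msym h(3) z by simp
    finally show "cnj (h (cnj z)) = h z" using Pzero z by simp
  qed
  obtain g where g: "g holomorphic_on D" "\<And>z. z \<in> D \<Longrightarrow> h z = exp (g z)"
    using D h(1,2) simply_connected_eq_holomorphic_log[OF open_D] by metis
  \<comment> \<open>If M vanished at all real points, it would vanish on D. At this x, h is a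
    quotient of positive reals and has the real logarithm c.\<close>
  obtain x where x: "complex_of_real x \<in> D" "M (of_real x) \<noteq> 0"
    using real_points_determine[OF Mholo, of "\<lambda>_. 0"] M(2) by auto
  define c where "c = ln (Re (h (of_real x)))"
  have hx: "h (of_real x) = exp (of_real c)"
  proof -
    define a where "a = Re (M (of_real x))"
    define b where "b = (norm (W (of_real x)))\<^sup>2"
    have a: "M (of_real x) = of_real a"
      using real_on_real(2)[OF M(1) x(1)] by (simp only: a_def)
    have b: "P (of_real x) = of_real b"
      unfolding P_def b_def complex_norm_square by simp
    have "a \<ge> 0" using nonneg[OF x(1)] by (simp add: a_def)
    moreover have "a \<noteq> 0" using x(2) a by auto
    moreover have "b \<ge> 0" by (simp add: b_def)
    moreover have "b \<noteq> 0" using Pzero[OF x(1)] x(2) b by auto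
    ultimately have "a / b > 0" by simp
    have "h (of_real x) = of_real (a / b)"
      using h(3)[OF x(1)] \<open>b \<noteq> 0\<close> by (simp add: a b field_simps)
    then show ?thesis
      using \<open>a / b > 0\<close> by (simp add: c_def exp_of_real del: of_real_divide)
  qed
  \<comment> \<open>A constant shift of the logarithm g, chosen so that G is real at x; it does not
    affect the exponential.\<close>
  define G where "G = (\<lambda>z. g z - g (of_real x) + of_real c)"
  have Gholo: "G holomorphic_on D"
    unfolding G_def by (intro holomorphic_intros g)
  have G: "exp (G z) = h z" if "z \<in> D" for z
    using g(2)[OF that] g(2)[OF x(1)] hx by (simp add: G_def exp_add exp_diff)
  define d where "d = (\<lambda>z. G z - cnj (G (cnj z)))"
  have dholo: "d holomorphic_on D"
    unfolding d_def by (intro holomorphic_intros Gholo holomorphic_on_cnj_cnj open_D cnj_D)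
  have "d z = 0" if "z \<in> D" for z
  proof (rule analytic_continuation_open[OF _ open_D _ connected_D _ dholo _ _ that])
    \<comment> \<open>The function d takes values in the integer multiples of 2 pi i. Radius 1 is
      below pi, so \<open>Ln\<close> inverts \<open>exp\<close> here and d vanishes near x, hence on
      D.\<close>
    let ?S = "D \<inter> d -` ball 0 1"
    show "open ?S"
      by (rule continuous_open_preimage[OF holomorphic_on_imp_continuous_on[OF dholo] open_D]) auto
    have "d (of_real x) = 0" by (simp add: d_def G_def)
    then show "?S \<noteq> {}" using x(1) by (auto intro!: exI[of _ "of_real x"])
    show "?S \<subseteq> D" by auto
    fix z assume z: "z \<in> ?S"
    have "exp (cnj (G (cnj z))) = h z"
      using G[OF cnj_D, of z] h_sym[of z] z by (simp flip: exp_cnj)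
    then have "exp (d z) = 1"
      using G[of z] h(2)[of z] z by (simp add: d_def exp_diff)
    moreover have "\<bar>Im (d z)\<bar> < 1"
      using z abs_Im_le_cmod[of "d z"] by simp
    then have "Ln (exp (d z)) = d z"
      using pi_gt3 by (intro Ln_exp) auto
    ultimately show "d z = 0" by simp
  qed auto
  then have G_sym: "cnj (G (cnj z)) = G z" if "z \<in> D" for z
    using that by (simp add: d_def)
  show thesis
  proof (rule that)
    show "(\<lambda>z. W z * exp (G z / 2)) holomorphic_on D"
      by (intro holomorphic_intros W Gholo) auto
    fix z assume z: "z \<in> D"
    have "W z * exp (G z / 2) * cnj (W (cnj z) * exp (G (cnj z) / 2)) =
        P z * (exp (G z / 2) * exp (cnj (G (cnj z)) / 2))"
      by (simp add: P_def exp_cnj)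
    also have "exp (G z / 2) * exp (cnj (G (cnj z)) / 2) = h z"
    proof -
      have "G z / 2 + G z / 2 = G z" by simp
      then show ?thesis unfolding G_sym[OF z] exp_add[symmetric] by (simp only: G[OF z])
    qed
    finally show "W z * exp (G z / 2) * cnj (W (cnj z) * exp (G (cnj z) / 2)) = M z"
      using h(3)[OF z] by (simp only: mult.commute)
  qed
qed

end

section \<open>Slices of the quaternions\<close>

lemma qcomp_of_real [simp]:
  "qRe (of_real r) = r" "qIm1 (of_real r) = 0" "qIm2 (of_real r) = 0" "qIm3 (of_real r) = 0"
  by (simp_all add: of_real_def)

lemma imag_units_iff:
  "J \<in> imag_units \<longleftrightarrow> qRe J = 0 \<and> (qIm1 J)\<^sup>2 + (qIm2 J)\<^sup>2 + (qIm3 J)\<^sup>2 = 1"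
proof
  assume "J \<in> imag_units"
  then have eqs: "qRe J * qRe J - qIm1 J * qIm1 J - qIm2 J * qIm2 J - qIm3 J * qIm3 J = - 1"
    "qRe J * qIm1 J = 0" "qRe J * qIm2 J = 0" "qRe J * qIm3 J = 0"
    by (auto simp: imag_units_def power2_eq_square quat_eq_iff)
  \<comment> \<open>A nonzero real part would force the vector part to vanish, and J would be a real
    square root of -1.\<close>
  have "qRe J = 0"
  proof (rule ccontr)
    assume "qRe J \<noteq> 0"
    with eqs have "qRe J * qRe J = - 1" by auto
    then show False using zero_le_square[of "qRe J"] by linarith
  qed
  with eqs show "qRe J = 0 \<and> (qIm1 J)\<^sup>2 + (qIm2 J)\<^sup>2 + (qIm3 J)\<^sup>2 = 1"
    by (auto simp: power2_eq_square)
qed (auto simp: imag_units_def power2_eq_square quat_eq_iff)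

lemma imag_units_square: "J \<in> imag_units \<Longrightarrow> J * J = - 1"
  by (simp add: imag_units_def power2_eq_square)

lemma imag_units_square': "J \<in> imag_units \<Longrightarrow> J * (J * x) = - x"
  using imag_units_square[of J] by (simp flip: mult.assoc)

lemma imag_units_uminus: "J \<in> imag_units \<Longrightarrow> - J \<in> imag_units"
  by (simp add: imag_units_def)

lemma quat_i_imag: "quat_i \<in> imag_units" and quat_j_imag: "quat_j \<in> imag_units"
  by (auto simp: imag_units_iff quat_i_def quat_j_def)

text \<open>For an imaginary unit J this is the algebra isomorphism of the complex numbers onto the
  slice plane of J. All slices are thereby described by one complex variable.\<close>

definition slice_pt :: "quat \<Rightarrow> complex \<Rightarrow> quat" where
  "slice_pt J z = of_real (Re z) + J * of_real (Im z)"

lemma slice_pt_scaleR: "slice_pt J z = Re z *\<^sub>R 1 + Im z *\<^sub>R J"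
  by (simp add: slice_pt_def of_real_def)

lemma slice_pt_bounded_linear: "bounded_linear (slice_pt J)"
proof -
  have "bounded_linear (\<lambda>z. Re z *\<^sub>R (1::quat) + Im z *\<^sub>R J)"
    by (intro bounded_linear_add bounded_linear_scaleR_const bounded_linear_Re bounded_linear_Im)
  then show ?thesis by (simp add: slice_pt_scaleR[abs_def])
qed

lemma slice_pt_0 [simp]: "slice_pt J 0 = 0"
  and slice_pt_add: "slice_pt J (z + w) = slice_pt J z + slice_pt J w"
  and slice_pt_diff: "slice_pt J (z - w) = slice_pt J z - slice_pt J w"
  using slice_pt_bounded_linear[THEN bounded_linear.linear]
  by (simp_all add: linear_0 linear_add linear_diff)

lemma slice_pt_of_real [simp]: "slice_pt J (of_real x) = of_real x"
  and slice_pt_1 [simp]: "slice_pt J 1 = 1"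
  and slice_pt_ii [simp]: "slice_pt J \<i> = J"
  by (simp_all add: slice_pt_def)

lemma slice_pt_cnj: "slice_pt J (cnj z) = slice_pt (- J) z"
  by (simp add: slice_pt_def)

lemma slice_pt_mult:
  assumes "J \<in> imag_units"
  shows "slice_pt J (z * w) = slice_pt J z * slice_pt J w"
  using imag_units_square[OF assms] by (simp add: slice_pt_scaleR algebra_simps)

lemma slice_pt_power: "J \<in> imag_units \<Longrightarrow> slice_pt J (z ^ n) = slice_pt J z ^ n"
  by (induction n) (simp_all add: slice_pt_mult)

lemma slice_pt_exists:
  obtains J z where "J \<in> imag_units" "q = slice_pt J z"
proof -
  define r where "r = sqrt ((qIm1 q)\<^sup>2 + (qIm2 q)\<^sup>2 + (qIm3 q)\<^sup>2)"
  show thesis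
  proof (cases "r = 0")
    case True
    then have "(qIm1 q)\<^sup>2 + (qIm2 q)\<^sup>2 + (qIm3 q)\<^sup>2 = 0"
      by (simp add: r_def)
    then have "qIm1 q = 0 \<and> qIm2 q = 0 \<and> qIm3 q = 0"
      by (simp add: add_nonneg_eq_0_iff)
    \<comment> \<open>A real quaternion has no direction of its own and lies in every slice;
      \<open>quat_i\<close> is an arbitrary choice.\<close>
    then show thesis
      by (intro that[OF quat_i_imag, of "of_real (qRe q)"]) (simp add: quat_eq_iff)
  next
    case False
    have r2: "r\<^sup>2 = (qIm1 q)\<^sup>2 + (qIm2 q)\<^sup>2 + (qIm3 q)\<^sup>2"
      by (simp add: r_def)
    show thesis
    proof (rule that)
      show "Quat 0 (qIm1 q / r) (qIm2 q / r) (qIm3 q / r) \<in> imag_units"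
        using False by (simp add: imag_units_iff power_divide flip: add_divide_distrib r2)
      show "q = slice_pt (Quat 0 (qIm1 q / r) (qIm2 q / r) (qIm3 q / r)) (Complex (qRe q) r)"
        using False by (simp add: slice_pt_scaleR quat_eq_iff)
    qed
  qed
qed

lemma slice_plane_eq: "slice_plane J = range (slice_pt J)"
proof
  show "slice_plane J \<subseteq> range (slice_pt J)"
    unfolding slice_plane_def
  proof (rule span_minimal)
    have "1 = slice_pt J 1" "J = slice_pt J \<i>" by simp_all
    then show "{1, J} \<subseteq> range (slice_pt J)" by blast
    show "subspace (range (slice_pt J))"
      by (intro linear_subspace_image bounded_linear.linear slice_pt_bounded_linear subspace_UNIV)
  qed
  show "range (slice_pt J) \<subseteq> slice_plane J"
  proof safe
    show "slice_pt J z \<in> slice_plane J" for z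
      unfolding slice_plane_def slice_pt_scaleR by (intro span_add span_scale span_base) auto
  qed
qed

text \<open>A real-linear functional that turns left multiplication by \<open>J\<close> into multiplication
  by the imaginary unit; it makes quaternion-valued slice functions amenable to
  the identity theorem.\<close>

definition slice_coord :: "quat \<Rightarrow> quat \<Rightarrow> quat \<Rightarrow> complex" where
  "slice_coord J v q = Complex (q \<bullet> v) (- (J * q) \<bullet> v)"

lemma slice_coord_bounded_linear: "bounded_linear (slice_coord J v)"
proof -
  have "bounded_linear (\<lambda>q. (q \<bullet> v) *\<^sub>R 1 + (- (J * q) \<bullet> v) *\<^sub>R \<i>)"
    by (intro bounded_linear_add bounded_linear_scaleR_const
        bounded_linear_compose[OF bounded_linear_inner_left] bounded_linear_inner_left
        bounded_linear_minus bounded_linear_mult_right)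
  moreover have "(\<lambda>q. (q \<bullet> v) *\<^sub>R 1 + (- (J * q) \<bullet> v) *\<^sub>R \<i>) = slice_coord J v"
    by (simp add: slice_coord_def fun_eq_iff complex_eq_iff)
  ultimately show ?thesis by simp
qed

lemma slice_coord_mult:
  assumes "J \<in> imag_units"
  shows "slice_coord J v (slice_pt J z * q) = z * slice_coord J v q"
  using imag_units_square'[OF assms]
  by (simp add: slice_coord_def slice_pt_scaleR complex_eq_iff algebra_simps inner_add_left
        inner_diff_left)

text \<open>For v = 1 the functional inverts the parametrization of the slice. It serves both to
  read off stem values and to show that \<open>slice_pt J\<close> is injective.\<close>

lemma slice_coord_1: "J \<in> imag_units \<Longrightarrow> slice_coord J 1 (slice_pt J z) = z"
  using slice_coord_mult[of J 1 z 1]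
  by (simp add: slice_coord_def inner_quat_def imag_units_iff complex_eq_iff)

lemma slice_coord_eqI:
  assumes "\<And>v. slice_coord J v p = slice_coord J v q"
  shows "p = q"
proof (rule euclidean_eqI)
  show "p \<bullet> v = q \<bullet> v" for v
    using assms[of v] by (simp add: slice_coord_def)
qed

text \<open>The Cauchy-Riemann equation says precisely that the real derivative is linear for the
  complex structure given by left multiplication by J; such a map is determined by its value c at
  1.\<close>

lemma slice_regular_iff:
  "f \<in> slice_regular \<Omega> \<longleftrightarrow> (\<forall>J\<in>imag_units. \<forall>z. slice_pt J z \<in> \<Omega> \<longrightarrow>
     (\<exists>c. ((\<lambda>w. f (slice_pt J w)) has_derivative (\<lambda>h. slice_pt J h * c)) (at z)))"
proof -
  have "(\<exists>D. ((\<lambda>(a, b). f (of_real a + J * of_real b)) has_derivative D) (at (\<alpha>, \<beta>)) \<and>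
             (1 / 2) *\<^sub>R (D (1, 0) + J * D (0, 1)) = 0) \<longleftrightarrow>
        (\<exists>c. ((\<lambda>w. f (slice_pt J w)) has_derivative (\<lambda>h. slice_pt J h * c)) (at (Complex \<alpha> \<beta>)))"
    (is "?L \<longleftrightarrow> ?R") if J: "J \<in> imag_units" for J \<alpha> \<beta>
  proof
    assume ?L
    then obtain D where D: "((\<lambda>(a, b). f (of_real a + J * of_real b)) has_derivative D) (at (\<alpha>, \<beta>))"
      "D (1, 0) + J * D (0, 1) = 0" by auto
    interpret D: bounded_linear D using D(1) by (rule has_derivative_bounded_linear)
    \<comment> \<open>Multiplying by J solves the equation for the second partial
      derivative.\<close>
    have "J * (D (1, 0) + J * D (0, 1)) = 0" using D(2) by simp
    then have D01: "D (0, 1) = J * D (1, 0)"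
      using imag_units_square'[OF J] by (simp add: distrib_left)
    have "((\<lambda>w. (Re w, Im w)) has_derivative (\<lambda>w. (Re w, Im w))) (at (Complex \<alpha> \<beta>))"
      by (auto intro!: derivative_eq_intros)
    from has_derivative_compose[OF this, of "\<lambda>(a, b). f (of_real a + J * of_real b)" D] D(1)
    have "((\<lambda>w. f (slice_pt J w)) has_derivative (\<lambda>h. D (Re h, Im h))) (at (Complex \<alpha> \<beta>))"
      by (simp add: slice_pt_def)
    moreover have "D (Re h, Im h) = slice_pt J h * D (1, 0)" for h
    proof -
      have "D (Re h, Im h) = D (Re h *\<^sub>R (1, 0) + Im h *\<^sub>R (0, 1))" by simp
      also have "\<dots> = Re h *\<^sub>R D (1, 0) + Im h *\<^sub>R D (0, 1)"
        by (simp only: D.add D.scaleR)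
      finally show ?thesis by (simp add: D01 slice_pt_scaleR distrib_right)
    qed
    ultimately show ?R by auto
  next
    assume ?R
    then obtain c where
      c: "((\<lambda>w. f (slice_pt J w)) has_derivative (\<lambda>h. slice_pt J h * c)) (at (Complex \<alpha> \<beta>))"
      by blast
    have Complex_eq: "(\<lambda>(a, b). Complex a b) = (\<lambda>x. complex_of_real (fst x) + \<i> * complex_of_real (snd x))"
      by (auto simp: fun_eq_iff complex_eq_iff)
    have "((\<lambda>(a, b). Complex a b) has_derivative (\<lambda>(a, b). Complex a b)) (at (\<alpha>, \<beta>))"
      unfolding Complex_eq by (auto intro!: derivative_eq_intros)
    from has_derivative_compose[OF this, of "\<lambda>w. f (slice_pt J w)" "\<lambda>h. slice_pt J h * c"] c
    have "((\<lambda>(a, b). f (of_real a + J * of_real b)) has_derivative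
        (\<lambda>(a, b). slice_pt J (Complex a b) * c)) (at (\<alpha>, \<beta>))"
      by (simp add: case_prod_unfold slice_pt_def)
    then show ?L
      using imag_units_square'[OF J]
      by (intro exI[of _ "\<lambda>(a, b). slice_pt J (Complex a b) * c"]) (simp add: slice_pt_scaleR)
  qed
  note key = this
  have "f \<in> slice_regular \<Omega> \<longleftrightarrow> (\<forall>J\<in>imag_units. \<forall>\<alpha> \<beta>. slice_pt J (Complex \<alpha> \<beta>) \<in> \<Omega> \<longrightarrow>
     (\<exists>c. ((\<lambda>w. f (slice_pt J w)) has_derivative (\<lambda>h. slice_pt J h * c)) (at (Complex \<alpha> \<beta>))))"
    unfolding slice_regular_def mem_Collect_eq
    by (intro ball_cong refl iff_allI imp_cong key) (simp add: slice_pt_def)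
  also have "\<dots> \<longleftrightarrow> (\<forall>J\<in>imag_units. \<forall>z. slice_pt J z \<in> \<Omega> \<longrightarrow>
     (\<exists>c. ((\<lambda>w. f (slice_pt J w)) has_derivative (\<lambda>h. slice_pt J h * c)) (at z)))"
  proof (intro ball_cong refl)
    have *: "(\<forall>a b. P (Complex a b)) \<longleftrightarrow> (\<forall>z. P z)" for P
      by (metis complex.collapse)
    show "(\<forall>\<alpha> \<beta>. slice_pt J (Complex \<alpha> \<beta>) \<in> \<Omega> \<longrightarrow>
       (\<exists>c. ((\<lambda>w. f (slice_pt J w)) has_derivative (\<lambda>h. slice_pt J h * c)) (at (Complex \<alpha> \<beta>))))
      \<longleftrightarrow> (\<forall>z. slice_pt J z \<in> \<Omega> \<longrightarrow>
     (\<exists>c. ((\<lambda>w. f (slice_pt J w)) has_derivative (\<lambda>h. slice_pt J h * c)) (at z)))" for J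
      by (rule *)
  qed
  finally show ?thesis .
qed

lemma slice_regular_add:
  assumes "f \<in> slice_regular \<Omega>" "g \<in> slice_regular \<Omega>"
  shows "(\<lambda>q. f q + g q) \<in> slice_regular \<Omega>"
  unfolding slice_regular_iff
proof safe
  fix J z assume "J \<in> imag_units" "slice_pt J z \<in> \<Omega>"
  then obtain c d where
    "((\<lambda>w. f (slice_pt J w)) has_derivative (\<lambda>h. slice_pt J h * c)) (at z)"
    "((\<lambda>w. g (slice_pt J w)) has_derivative (\<lambda>h. slice_pt J h * d)) (at z)"
    using assms unfolding slice_regular_iff by meson
  from has_derivative_add[OF this]
  show "\<exists>c. ((\<lambda>w. f (slice_pt J w) + g (slice_pt J w)) has_derivative
      (\<lambda>h. slice_pt J h * c)) (at z)"
    by (intro exI[of _ "c + d"]) (simp add: distrib_left)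
qed

text \<open>The constant stands on the right, where it is absorbed into c; on the left it would have
  to commute with J.\<close>

lemma slice_regular_mult_const:
  assumes "f \<in> slice_regular \<Omega>"
  shows "(\<lambda>q. f q * a) \<in> slice_regular \<Omega>"
  unfolding slice_regular_iff
proof safe
  fix J z assume "J \<in> imag_units" "slice_pt J z \<in> \<Omega>"
  then obtain c where
    "((\<lambda>w. f (slice_pt J w)) has_derivative (\<lambda>h. slice_pt J h * c)) (at z)"
    using assms unfolding slice_regular_iff by meson
  from has_derivative_mult_left[OF this, of a]
  show "\<exists>c. ((\<lambda>w. f (slice_pt J w) * a) has_derivative (\<lambda>h. slice_pt J h * c)) (at z)"
    by (intro exI[of _ "c * a"]) (simp add: mult.assoc)
qed

section \<open>Uniqueness of slice coordinates, components and orders\<close>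

lemma imag_units_norm: "J \<in> imag_units \<Longrightarrow> norm J = 1"
  by (simp add: imag_units_iff norm_quat_def)

text \<open>Comparing real parts and the norms of the imaginary parts leaves only a choice of sign.
  These are the ambiguities that a function defined through slices has to respect.\<close>

lemma slice_pt_eqD:
  assumes "J \<in> imag_units" "K \<in> imag_units" "slice_pt J z = slice_pt K w"
  shows "z = w \<and> Im z = 0 \<or> z = w \<and> J = K \<or> z = cnj w \<and> J = - K"
proof -
  have Re: "Re z = Re w"
    using arg_cong[OF assms(3), of qRe] assms(1,2) by (simp add: slice_pt_scaleR imag_units_iff)
  then have eq: "Im z *\<^sub>R J = Im w *\<^sub>R K"
    using assms(3) by (simp add: slice_pt_scaleR)
  then have "\<bar>Im z\<bar> = \<bar>Im w\<bar>"
  proof -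
    have "norm (Im z *\<^sub>R J) = norm (Im w *\<^sub>R K)" by (simp only: eq)
    then show ?thesis using imag_units_norm assms(1,2) by simp
  qed
  then consider "Im z = 0" "Im w = 0" | "Im z \<noteq> 0" "Im w = Im z" | "Im z \<noteq> 0" "Im w = - Im z"
    by linarith
  then show ?thesis
  proof cases
    case 1
    then show ?thesis using Re by (simp add: complex_eq_iff)
  next
    case 2
    then have "J = K" using eq by simp
    then show ?thesis using 2 Re by (simp add: complex_eq_iff)
  next
    case 3
    then have "Im z *\<^sub>R J = Im z *\<^sub>R (- K)" using eq by simp
    then have "J = - K" using 3 by (metis real_vector.scale_left_imp_eq)
    then show ?thesis using 3 Re by (simp add: complex_eq_iff)
  qed
qed

text \<open>One unit yields four real equations for eight real unknowns. The units
  \<open>quat_i\<close> and \<open>- quat_i\<close> together suffice: the sum isolates the real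
  parts, the difference the imaginary parts.\<close>

lemma slice_pt_units_independent:
  assumes "\<And>J. J \<in> imag_units \<Longrightarrow>
    slice_pt J a + slice_pt J b * quat_i + slice_pt J c * quat_j + slice_pt J d * quat_k =
    slice_pt J a' + slice_pt J b' * quat_i + slice_pt J c' * quat_j + slice_pt J d' * quat_k"
  shows "a = a' \<and> b = b' \<and> c = c' \<and> d = d'"
  using assms[OF quat_i_imag] assms[OF imag_units_uminus[OF quat_i_imag]]
  by (simp add: slice_pt_scaleR quat_eq_iff complex_eq_iff quat_i_def quat_j_def quat_k_def)

text \<open>If k < m, cancelling the smaller power for t different from x and letting t tend to x
  gives \<open>f x = 0\<close>. The situation is symmetric in f and g.\<close>

lemma power_factor_unique:
  fixes f g :: "real \<Rightarrow> 'a :: real_normed_vector"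
  assumes f: "isCont f x" "f x \<noteq> 0" and g: "isCont g x" "g x \<noteq> 0"
    and eq: "\<forall>\<^sub>F t in at x. (t - x) ^ k *\<^sub>R f t = (t - x) ^ m *\<^sub>R g t"
  shows "k = m"
proof -
  have *: "m \<le> k" if "isCont f x" "f x \<noteq> 0" "isCont g x"
    "\<forall>\<^sub>F t in at x. (t - x) ^ k *\<^sub>R f t = (t - x) ^ m *\<^sub>R g t"
    for f g :: "real \<Rightarrow> 'a" and k m
  proof (rule ccontr)
    assume "\<not> m \<le> k"
    then have m: "m = k + (m - k)" "m - k > 0" by auto
    have "\<forall>\<^sub>F t in at x. f t = (t - x) ^ (m - k) *\<^sub>R g t"
      using that(4) eventually_neq_at_within[of x x UNIV]
    proof eventually_elim
      case (elim t)
      have "(t - x) ^ m = (t - x) ^ k * (t - x) ^ (m - k)"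
        using m(1) by (metis power_add)
      then have "(t - x) ^ k *\<^sub>R f t = (t - x) ^ k *\<^sub>R ((t - x) ^ (m - k) *\<^sub>R g t)"
        using elim by simp
      moreover have "(t - x) ^ k \<noteq> 0" using elim by simp
      ultimately show ?case using scaleR_left_imp_eq by blast
    qed
    moreover have "((\<lambda>t. (t - x) ^ (m - k) *\<^sub>R g t) \<longlongrightarrow> (x - x) ^ (m - k) *\<^sub>R g x) (at x)"
      using that(3) by (intro tendsto_intros) (simp add: isCont_def)
    ultimately have "(f \<longlongrightarrow> (x - x) ^ (m - k) *\<^sub>R g x) (at x)"
      by (simp add: tendsto_cong)
    moreover have "(f \<longlongrightarrow> f x) (at x)" using that(1) by (simp add: isCont_def)
    ultimately have "f x = (x - x) ^ (m - k) *\<^sub>R g x"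
      by (rule tendsto_unique[OF at_neq_bot, rotated])
    then show False using that(2) m(2) by simp
  qed
  have eq': "\<forall>\<^sub>F t in at x. (t - x) ^ m *\<^sub>R g t = (t - x) ^ k *\<^sub>R f t"
    using eq by eventually_elim simp
  from *[OF f g(1) eq] *[OF g f(1) eq'] show ?thesis by simp
qed

section \<open>Stem functions on symmetric slice domains\<close>

locale slice_domain =
  fixes \<Omega> :: "quat set"
  assumes ssd: "symmetric_slice_domain \<Omega>"
    and simply_connected_slice: "\<exists>I\<in>imag_units. simply_connected (\<Omega> \<inter> slice_plane I)"
begin

text \<open>The choice of \<open>quat_i\<close> is immaterial: by the symmetry of \<Omega> every
  imaginary unit gives the same set.\<close>

definition D :: "complex set" where
  "D = {z. slice_pt quat_i z \<in> \<Omega>}"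

lemma slice_pt_in_iff: "J \<in> imag_units \<Longrightarrow> slice_pt J z \<in> \<Omega> \<longleftrightarrow> z \<in> D"
  using ssd quat_i_imag unfolding symmetric_slice_domain_def D_def slice_pt_def by blast

lemma of_real_in_iff: "of_real x \<in> \<Omega> \<longleftrightarrow> complex_of_real x \<in> D"
  using slice_pt_in_iff[OF quat_i_imag, of "of_real x"] by simp

lemma point_cases:
  assumes "q \<in> \<Omega>"
  obtains J z where "J \<in> imag_units" "z \<in> D" "q = slice_pt J z"
  using assms slice_pt_exists slice_pt_in_iff by metis

lemma simply_connected_D: "simply_connected D"
proof -
  obtain I where I: "I \<in> imag_units" "simply_connected (\<Omega> \<inter> slice_plane I)"
    using simply_connected_slice by blast
  have im: "slice_pt I ` D = \<Omega> \<inter> range (slice_pt I)"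
    using slice_pt_in_iff[OF I(1)] by auto
  have "homeomorphism D (\<Omega> \<inter> slice_plane I) (slice_pt I) (slice_coord I 1)"
    unfolding homeomorphism_def slice_plane_eq
  proof (intro conjI ballI)
    show "slice_pt I ` D = \<Omega> \<inter> range (slice_pt I)" by (rule im)
    show "slice_coord I 1 ` (\<Omega> \<inter> range (slice_pt I)) = D"
      unfolding im[symmetric] image_image by (simp add: slice_coord_1[OF I(1)])
    show "continuous_on D (slice_pt I)" "continuous_on (\<Omega> \<inter> range (slice_pt I)) (slice_coord I 1)"
      by (intro linear_continuous_on slice_pt_bounded_linear slice_coord_bounded_linear)+
  qed (use slice_coord_1[OF I(1)] in auto)
  then have "D homeomorphic (\<Omega> \<inter> slice_plane I)"
    unfolding homeomorphic_def by blast
  with I(2) show ?thesis by (simp add: homeomorphic_simply_connected_eq)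
qed

sublocale symmetric_domain D
proof
  have "open (slice_pt quat_i -` \<Omega>)"
    using ssd by (intro open_vimage linear_continuous_on slice_pt_bounded_linear)
      (auto simp: symmetric_slice_domain_def)
  then show "open D" by (simp add: D_def vimage_def)
  show "connected D" by (rule simply_connected_imp_connected[OF simply_connected_D])
  show "cnj z \<in> D" if "z \<in> D" for z
    using that slice_pt_in_iff[OF imag_units_uminus[OF quat_i_imag]]
    by (simp add: D_def slice_pt_cnj)
  obtain q where "q \<in> \<Omega>" "q \<in> \<real>"
    using ssd by (auto simp: symmetric_slice_domain_def)
  then show "\<exists>x. complex_of_real x \<in> D"
    by (metis Reals_cases of_real_in_iff)
qed

text \<open>The point is the order of quantifiers: a single F describes f in every slice.\<close>

definition has_stem :: "(quat \<Rightarrow> quat) \<Rightarrow> (complex \<Rightarrow> complex) \<Rightarrow> bool" where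
  "has_stem f F \<longleftrightarrow> (\<forall>J\<in>imag_units. \<forall>z\<in>D. f (slice_pt J z) = slice_pt J (F z))"

text \<open>The stem form of h = h0 + h1 I with slice preserving h0 and h1. As in the decomposition
  along i, j, k, the unit stands on the right.\<close>

definition has_stems :: "quat \<Rightarrow> (quat \<Rightarrow> quat) \<Rightarrow> (complex \<Rightarrow> complex) \<Rightarrow> (complex \<Rightarrow> complex) \<Rightarrow> bool" where
  "has_stems I h F G \<longleftrightarrow>
     (\<forall>J\<in>imag_units. \<forall>z\<in>D. h (slice_pt J z) = slice_pt J (F z) + slice_pt J (G z) * I)"

lemma has_stemD:
  "has_stem f F \<Longrightarrow> J \<in> imag_units \<Longrightarrow> z \<in> D \<Longrightarrow> f (slice_pt J z) = slice_pt J (F z)"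
  by (simp add: has_stem_def)

lemma has_stemsD:
  "has_stems I h F G \<Longrightarrow> J \<in> imag_units \<Longrightarrow> z \<in> D \<Longrightarrow>
    h (slice_pt J z) = slice_pt J (F z) + slice_pt J (G z) * I"
  by (simp add: has_stems_def)

text \<open>The functional turns the derivative \<open>slice_pt J h * c\<close> into multiplication
  of h by a complex number, which is complex differentiability.\<close>

lemma slice_coord_holomorphic:
  assumes f: "f \<in> slice_regular \<Omega>" and J: "J \<in> imag_units"
  shows "(\<lambda>z. slice_coord J v (f (slice_pt J z))) holomorphic_on D"
proof -
  have "\<exists>d. ((\<lambda>z. slice_coord J v (f (slice_pt J z))) has_field_derivative d) (at z)"
    if z: "z \<in> D" for z
  proof -
    obtain c where "((\<lambda>w. f (slice_pt J w)) has_derivative (\<lambda>h. slice_pt J h * c)) (at z)"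
      using f J z slice_pt_in_iff[OF J] unfolding slice_regular_iff by blast
    from bounded_linear.has_derivative[OF slice_coord_bounded_linear[of J v] this]
    have "((\<lambda>w. slice_coord J v (f (slice_pt J w))) has_derivative
        (\<lambda>h. h * slice_coord J v c)) (at z)"
      by (simp add: slice_coord_mult[OF J])
    then have "((\<lambda>w. slice_coord J v (f (slice_pt J w))) has_field_derivative slice_coord J v c) (at z)"
      by (rule has_derivative_imp_has_field_derivative) simp
    then show ?thesis by blast
  qed
  then show ?thesis
    unfolding holomorphic_on_open[OF open_D] by blast
qed

text \<open>Each slice contains all real points of \<Omega>, and the complex coordinates of both
  functions on that slice are holomorphic, so agreement spreads from the real axis.\<close>

lemma slice_regular_eqI:
  assumes f: "f \<in> slice_regular \<Omega>" and g: "g \<in> slice_regular \<Omega>"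
    and eq: "\<And>x. of_real x \<in> \<Omega> \<Longrightarrow> f (of_real x) = g (of_real x)" and q: "q \<in> \<Omega>"
  shows "f q = g q"
proof -
  obtain J z where J: "J \<in> imag_units" "z \<in> D" and qz: "q = slice_pt J z"
    using q by (rule point_cases)
  have "f (slice_pt J z) = g (slice_pt J z)"
  proof (rule slice_coord_eqI)
    show "slice_coord J v (f (slice_pt J z)) = slice_coord J v (g (slice_pt J z))" for v
      by (rule real_points_determine[OF slice_coord_holomorphic[OF f J(1)]
            slice_coord_holomorphic[OF g J(1)] _ J(2)])
         (simp add: eq of_real_in_iff)
  qed
  then show ?thesis by (simp add: qz)
qed

lemma slice_regularI:
  assumes F: "F holomorphic_on D"
    and f: "has_stem f F"
  shows "f \<in> slice_regular \<Omega>"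
  unfolding slice_regular_iff
proof safe
  fix J z assume J: "J \<in> imag_units" and "slice_pt J z \<in> \<Omega>"
  then have z: "z \<in> D" by (simp add: slice_pt_in_iff)
  obtain d where "(F has_field_derivative d) (at z)"
    using F z unfolding holomorphic_on_open[OF open_D] by blast
  then have "(F has_derivative (\<lambda>h. h * d)) (at z)"
    by (simp only: has_field_derivative_def mult.commute[of _ d])
  from bounded_linear.has_derivative[OF slice_pt_bounded_linear this, of J]
  have "((\<lambda>w. slice_pt J (F w)) has_derivative (\<lambda>h. slice_pt J h * slice_pt J d)) (at z)"
    by (simp add: slice_pt_mult[OF J])
  then have "((\<lambda>w. f (slice_pt J w)) has_derivative (\<lambda>h. slice_pt J h * slice_pt J d)) (at z)"
    by (rule has_derivative_transform_within_open[OF _ open_D z]) (simp add: has_stemD[OF f J])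
  then show "\<exists>c. ((\<lambda>w. f (slice_pt J w)) has_derivative (\<lambda>h. slice_pt J h * c)) (at z)" ..
qed

lemma slice_preservingI:
  assumes "real_on F"
    and f: "has_stem f F"
  shows "f \<in> slice_preserving \<Omega>"
  using slice_regularI[OF real_onD(1)[OF assms(1)] f] slice_pt_in_iff f
  by (auto simp: slice_preserving_def slice_plane_eq has_stem_def)

text \<open>In each slice f is given by some holomorphic function. At real points all of these take
  the same real value, so they coincide by the identity theorem.\<close>

lemma slice_preserving_stem:
  assumes f: "f \<in> slice_preserving \<Omega>"
  obtains F where "real_on F" "has_stem f F"
proof -
  have reg: "f \<in> slice_regular \<Omega>" using f by (simp add: slice_preserving_def)
  define G where "G = (\<lambda>J z. slice_coord J 1 (f (slice_pt J z)))"
  have G: "f (slice_pt J z) = slice_pt J (G J z)" if J: "J \<in> imag_units" and z: "z \<in> D" for J z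
  proof -
    have "f (slice_pt J z) \<in> range (slice_pt J)"
      using f J slice_pt_in_iff[OF J, of z] z
      unfolding slice_preserving_def slice_plane_eq by blast
    then show ?thesis using slice_coord_1[OF J] by (auto simp: G_def)
  qed
  have Gholo: "G J holomorphic_on D" if "J \<in> imag_units" for J
    unfolding G_def by (rule slice_coord_holomorphic[OF reg that])
  have Greal: "G J (of_real x) = of_real (qRe (f (of_real x)))"
    if J: "J \<in> imag_units" and x: "complex_of_real x \<in> D" for J x
  proof -
    \<comment> \<open>The value at a real point lies in the slice planes of both i and j, which meet
      only in the reals.\<close>
    have "slice_pt quat_i (G quat_i (of_real x)) = slice_pt quat_j (G quat_j (of_real x))"
      using G[OF quat_i_imag x] G[OF quat_j_imag x] by simp
    then have "Im (G quat_i (of_real x)) = 0"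
      by (simp add: slice_pt_scaleR quat_eq_iff quat_i_def quat_j_def)
    then have "f (of_real x) = of_real (Re (G quat_i (of_real x)))"
      using G[OF quat_i_imag x] by (simp add: slice_pt_def)
    then obtain r where r: "f (of_real x) = of_real r" by blast
    then have "G J (of_real x) = slice_coord J 1 (slice_pt J (of_real r))"
      by (simp add: G_def)
    then show ?thesis using r by (simp only: slice_coord_1[OF J] qcomp_of_real)
  qed
  have eq: "G J z = G quat_i z" if "J \<in> imag_units" "z \<in> D" for J z
    by (rule real_points_determine[OF Gholo Gholo _ that(2)])
       (use Greal that(1) quat_i_imag in auto)
  \<comment> \<open>The point over \<open>cnj z\<close> in the slice of i is the point over z in the
    slice of -i, and both units have the same stem.\<close>
  have "G quat_i (cnj z) = cnj (G quat_i z)" if z: "z \<in> D" for z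
  proof -
    have m: "- quat_i \<in> imag_units" by (rule imag_units_uminus[OF quat_i_imag])
    have "slice_pt quat_i (G quat_i (cnj z)) = f (slice_pt quat_i (cnj z))"
      by (rule G[OF quat_i_imag cnj_D[OF z], symmetric])
    also have "\<dots> = slice_pt (- quat_i) (G (- quat_i) z)"
      unfolding slice_pt_cnj by (rule G[OF m z])
    also have "\<dots> = slice_pt quat_i (cnj (G quat_i z))"
      by (simp add: slice_pt_cnj eq[OF m z])
    finally show ?thesis
      using slice_coord_1[OF quat_i_imag] by metis
  qed
  then have "real_on (G quat_i)" by (simp add: real_on_def Gholo quat_i_imag)
  then show thesis using that[of "G quat_i"] G eq by (simp add: has_stem_def)
qed

text \<open>A point may be written as \<open>slice_pt J z\<close> in several ways. Reflection
  symmetry makes the value the same for J, z and for \<open>- J\<close>, \<open>cnj z\<close>; at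
  real points F is real, so J drops out.\<close>

lemma stem_extension:
  assumes F: "real_on F"
  obtains f where "f \<in> slice_preserving \<Omega>" "has_stem f F"
proof -
  have welldef: "slice_pt K (F w) = slice_pt J (F z)"
    if "J \<in> imag_units" "K \<in> imag_units" "z \<in> D" "w \<in> D" "slice_pt K w = slice_pt J z" for J K z w
    using slice_pt_eqD[OF that(2,1,5)]
  proof (elim disjE conjE)
    assume w: "w = z" "Im w = 0"
    then have "z = of_real (Re z)" by (simp add: complex_eq_iff)
    then have "Im (F z) = 0" using real_on_real(1)[OF F, of "Re z"] that(3) by metis
    then show ?thesis using w by (simp add: slice_pt_def)
  next
    assume "w = cnj z" "K = - J"
    then show ?thesis
      using real_onD(2)[OF F that(3)] by (simp flip: slice_pt_cnj)
  qed simp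
  \<comment> \<open>On \<Omega> the choice has exactly one candidate; outside \<Omega> it has none
    and the value is arbitrary.\<close>
  define f where "f = (\<lambda>q. SOME y. \<exists>J\<in>imag_units. \<exists>z\<in>D. q = slice_pt J z \<and> y = slice_pt J (F z))"
  have f: "f (slice_pt J z) = slice_pt J (F z)" if "J \<in> imag_units" "z \<in> D" for J z
    unfolding f_def
  proof (rule some_equality)
    show "y = slice_pt J (F z)"
      if "\<exists>K\<in>imag_units. \<exists>w\<in>D. slice_pt J z = slice_pt K w \<and> y = slice_pt K (F w)" for y
      using that welldef \<open>J \<in> imag_units\<close> \<open>z \<in> D\<close> by metis
  qed (use that in blast)
  then have "has_stem f F" by (simp add: has_stem_def)
  from that[OF slice_preservingI[OF F this] this] show thesis .
qed


text \<open>Not the pointwise real part: on the real axis it agrees with the real part of H, and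
  elsewhere it is the holomorphic extension of that. The same holds for
  \<open>im_part\<close>.\<close>

definition re_part :: "(complex \<Rightarrow> complex) \<Rightarrow> complex \<Rightarrow> complex" where
  "re_part H z = (H z + cnj (H (cnj z))) / 2"

definition im_part :: "(complex \<Rightarrow> complex) \<Rightarrow> complex \<Rightarrow> complex" where
  "im_part H z = (H z - cnj (H (cnj z))) / (2 * \<i>)"

lemma real_on_parts:
  assumes "H holomorphic_on D"
  shows "real_on (re_part H)" "real_on (im_part H)"
proof -
  have "(\<lambda>z. cnj (H (cnj z))) holomorphic_on D"
    by (rule holomorphic_on_cnj_cnj[OF assms open_D cnj_D])
  then have "re_part H holomorphic_on D" "im_part H holomorphic_on D"
    unfolding re_part_def[abs_def] im_part_def[abs_def]
    using assms by (auto intro!: holomorphic_intros)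
  moreover have "re_part H (cnj z) = cnj (re_part H z)" for z
    by (simp add: re_part_def add.commute)
  moreover have "im_part H (cnj z) = cnj (im_part H z)" for z
    by (simp add: im_part_def) (simp add: algebra_simps)
  ultimately show "real_on (re_part H)" "real_on (im_part H)"
    by (simp_all add: real_on_def)
qed

lemma re_im_part: "re_part H z + im_part H z * \<i> = H z"
  by (simp add: re_part_def im_part_def field_simps)

text \<open>With A = \<open>H z\<close> and B = \<open>cnj (H (cnj z))\<close> this is ((A + B)/2)^2
  - ((A - B)/2)^2 = A B.\<close>

lemma re_im_part_norm: "(re_part H z)\<^sup>2 + (im_part H z)\<^sup>2 = H z * cnj (H (cnj z))"
  by (simp add: re_part_def im_part_def power2_eq_square field_simps)

section \<open>The symmetrized function in terms of stems\<close>

lemma real_on_scale: "real_on F \<Longrightarrow> real_on (\<lambda>z. of_real a * F z)"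
  by (auto simp: real_on_def intro!: holomorphic_intros)

text \<open>\<open>symmetrized\<close> is a definite description, so one decomposition along i, j, k
  must be exhibited and every other one shown to give the same value.\<close>

lemma symmetrized_eq:
  assumes F: "real_on F" and G: "real_on G" and I: "I \<in> imag_units"
    and h: "has_stems I h F G"
    and J: "J \<in> imag_units" and z: "z \<in> D"
  shows "symmetrized \<Omega> h (slice_pt J z) = slice_pt J ((F z)\<^sup>2 + (G z)\<^sup>2)"
proof -
  \<comment> \<open>Expanding I in i, j, k, the components of h have stems F, aG, bG, cG; the
    squares of the last three add up to that of G.\<close>
  define a b c where "a = qIm1 I" "b = qIm2 I" "c = qIm3 I"
  have abc: "a\<^sup>2 + b\<^sup>2 + c\<^sup>2 = 1" and I_eq: "I = a *\<^sub>R quat_i + b *\<^sub>R quat_j + c *\<^sub>R quat_k"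
    using I by (auto simp: imag_units_iff a_b_c_def quat_eq_iff quat_i_def quat_j_def quat_k_def)
  have dec: "h (slice_pt J z) = slice_pt J (F z) + slice_pt J (of_real a * G z) * quat_i +
      slice_pt J (of_real b * G z) * quat_j + slice_pt J (of_real c * G z) * quat_k"
    if J: "J \<in> imag_units" and z: "z \<in> D" for J z
  proof -
    have "slice_pt J (of_real r * w) = r *\<^sub>R slice_pt J w" for r w
      by (simp add: slice_pt_scaleR algebra_simps)
    then show ?thesis
      by (simp add: has_stemsD[OF h J z] I_eq distrib_left)
  qed
  have sq: "(slice_pt J x)\<^sup>2 = slice_pt J (x\<^sup>2)" if "J \<in> imag_units" for J x
    using slice_pt_power[OF that] by simp
  have val: "(slice_pt J (F z))\<^sup>2 + (slice_pt J (of_real a * G z))\<^sup>2 +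
      (slice_pt J (of_real b * G z))\<^sup>2 + (slice_pt J (of_real c * G z))\<^sup>2 =
      slice_pt J ((F z)\<^sup>2 + (G z)\<^sup>2)"
  proof -
    have eq: "(F z)\<^sup>2 + (of_real a * G z)\<^sup>2 + (of_real b * G z)\<^sup>2 + (of_real c * G z)\<^sup>2 =
        (F z)\<^sup>2 + (G z)\<^sup>2"
    proof -
      have "(of_real a * G z)\<^sup>2 + (of_real b * G z)\<^sup>2 + (of_real c * G z)\<^sup>2 =
          of_real (a\<^sup>2 + b\<^sup>2 + c\<^sup>2) * (G z)\<^sup>2"
        by (simp add: power_mult_distrib algebra_simps)
      then show ?thesis unfolding abc by (simp add: add.assoc)
    qed
    show ?thesis
      by (simp only: sq[OF J] eq slice_pt_add[symmetric])
  qed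
  obtain f0 where f0: "f0 \<in> slice_preserving \<Omega>" "has_stem f0 F"
    using stem_extension[OF F] by blast
  obtain f1 where f1: "f1 \<in> slice_preserving \<Omega>" "has_stem f1 (\<lambda>z. of_real a * G z)"
    using stem_extension[OF real_on_scale[OF G, of a]] by blast
  obtain f2 where f2: "f2 \<in> slice_preserving \<Omega>" "has_stem f2 (\<lambda>z. of_real b * G z)"
    using stem_extension[OF real_on_scale[OF G, of b]] by blast
  obtain f3 where f3: "f3 \<in> slice_preserving \<Omega>" "has_stem f3 (\<lambda>z. of_real c * G z)"
    using stem_extension[OF real_on_scale[OF G, of c]] by blast
  show ?thesis
    unfolding symmetrized_def
  proof (rule the_equality)
    have "h p = f0 p + f1 p * quat_i + f2 p * quat_j + f3 p * quat_k" if "p \<in> \<Omega>" for p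
      using that
    proof (rule point_cases)
      fix K w assume "K \<in> imag_units" "w \<in> D" "p = slice_pt K w"
      then show ?thesis using f0(2) f1(2) f2(2) f3(2) dec by (simp add: has_stem_def)
    qed
    moreover have "slice_pt J ((F z)\<^sup>2 + (G z)\<^sup>2) = (f0 (slice_pt J z))\<^sup>2 +
        (f1 (slice_pt J z))\<^sup>2 + (f2 (slice_pt J z))\<^sup>2 + (f3 (slice_pt J z))\<^sup>2"
      unfolding has_stemD[OF f0(2) J z] has_stemD[OF f1(2) J z] has_stemD[OF f2(2) J z] has_stemD[OF f3(2) J z] by (rule val[symmetric])
    ultimately show "\<exists>f0 \<in> slice_preserving \<Omega>. \<exists>f1 \<in> slice_preserving \<Omega>.
             \<exists>f2 \<in> slice_preserving \<Omega>. \<exists>f3 \<in> slice_preserving \<Omega>.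
        (\<forall>p\<in>\<Omega>. h p = f0 p + f1 p * quat_i + f2 p * quat_j + f3 p * quat_k) \<and>
        slice_pt J ((F z)\<^sup>2 + (G z)\<^sup>2) = (f0 (slice_pt J z))\<^sup>2 + (f1 (slice_pt J z))\<^sup>2 +
          (f2 (slice_pt J z))\<^sup>2 + (f3 (slice_pt J z))\<^sup>2"
      using f0(1) f1(1) f2(1) f3(1) by blast
  next
    fix w
    assume "\<exists>f0 \<in> slice_preserving \<Omega>. \<exists>f1 \<in> slice_preserving \<Omega>.
             \<exists>f2 \<in> slice_preserving \<Omega>. \<exists>f3 \<in> slice_preserving \<Omega>.
        (\<forall>p\<in>\<Omega>. h p = f0 p + f1 p * quat_i + f2 p * quat_j + f3 p * quat_k) \<and>
        w = (f0 (slice_pt J z))\<^sup>2 + (f1 (slice_pt J z))\<^sup>2 +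
          (f2 (slice_pt J z))\<^sup>2 + (f3 (slice_pt J z))\<^sup>2"
    then obtain g0 g1 g2 g3 where g: "g0 \<in> slice_preserving \<Omega>" "g1 \<in> slice_preserving \<Omega>"
      "g2 \<in> slice_preserving \<Omega>" "g3 \<in> slice_preserving \<Omega>"
      and h_eq: "\<forall>p\<in>\<Omega>. h p = g0 p + g1 p * quat_i + g2 p * quat_j + g3 p * quat_k"
      and w: "w = (g0 (slice_pt J z))\<^sup>2 + (g1 (slice_pt J z))\<^sup>2 +
          (g2 (slice_pt J z))\<^sup>2 + (g3 (slice_pt J z))\<^sup>2"
      by blast
    obtain G0 where G0: "has_stem g0 G0"
      using slice_preserving_stem[OF g(1)] by blast
    obtain G1 where G1: "has_stem g1 G1"
      using slice_preserving_stem[OF g(2)] by blast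
    obtain G2 where G2: "has_stem g2 G2"
      using slice_preserving_stem[OF g(3)] by blast
    obtain G3 where G3: "has_stem g3 G3"
      using slice_preserving_stem[OF g(4)] by blast
    \<comment> \<open>A competing decomposition is compared at the same z in all slices at once,
      which determines its four stem values.\<close>
    have "G0 z = F z \<and> G1 z = of_real a * G z \<and> G2 z = of_real b * G z \<and> G3 z = of_real c * G z"
    proof (rule slice_pt_units_independent)
      fix K assume K: "K \<in> imag_units"
      have "slice_pt K z \<in> \<Omega>" using slice_pt_in_iff[OF K] z by simp
      with h_eq dec[OF K z] has_stemD[OF G0 K z] has_stemD[OF G1 K z] has_stemD[OF G2 K z] has_stemD[OF G3 K z]
      show "slice_pt K (G0 z) + slice_pt K (G1 z) * quat_i + slice_pt K (G2 z) * quat_j +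
          slice_pt K (G3 z) * quat_k =
        slice_pt K (F z) + slice_pt K (of_real a * G z) * quat_i +
          slice_pt K (of_real b * G z) * quat_j + slice_pt K (of_real c * G z) * quat_k"
        by metis
    qed
    then show "w = slice_pt J ((F z)\<^sup>2 + (G z)\<^sup>2)"
      unfolding w has_stemD[OF G0 J z] has_stemD[OF G1 J z] has_stemD[OF G2 J z] has_stemD[OF G3 J z] using val by simp
  qed
qed

section \<open>Functions preserving a single slice\<close>

lemma slice_regular_of_parts:
  assumes F: "real_on F" and G: "real_on G"
  obtains h where "h \<in> slice_regular \<Omega>" "has_stems I h F G"
proof -
  obtain f where f: "f \<in> slice_preserving \<Omega>" "has_stem f F"
    using stem_extension[OF F] by blast
  obtain g where g: "g \<in> slice_preserving \<Omega>" "has_stem g G"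
    using stem_extension[OF G] by blast
  show thesis
  proof (rule that[of "\<lambda>q. f q + g q * I"])
    show "(\<lambda>q. f q + g q * I) \<in> slice_regular \<Omega>"
      using f(1) g(1)
      by (intro slice_regular_add slice_regular_mult_const) (auto simp: slice_preserving_def)
  qed (use f(2) g(2) in \<open>simp add: has_stem_def has_stems_def\<close>)
qed

lemma slice_pt_parts:
  assumes "I \<in> imag_units"
  shows "slice_pt I (re_part H z) + slice_pt I (im_part H z) * I = slice_pt I (H z)"
proof -
  have "slice_pt I (re_part H z) + slice_pt I (im_part H z) * I =
      slice_pt I (re_part H z + im_part H z * \<i>)"
    by (simp add: slice_pt_add slice_pt_mult[OF assms])
  then show ?thesis by (simp only: re_im_part)
qed

text \<open>H is read off in the slice of I alone. The function rebuilt from its two parts agrees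
  with h at real points, and therefore in every slice.\<close>

lemma slice_regular_preserving_stem:
  assumes I: "I \<in> imag_units" and h: "h \<in> slice_regular_preserving \<Omega> I"
  obtains H where "H holomorphic_on D" "has_stems I h (re_part H) (im_part H)"
proof -
  have reg: "h \<in> slice_regular \<Omega>" and img: "h ` (\<Omega> \<inter> slice_plane I) \<subseteq> slice_plane I"
    using h by (auto simp: slice_regular_preserving_def)
  define H where "H = (\<lambda>z. slice_coord I 1 (h (slice_pt I z)))"
  have H: "H holomorphic_on D"
    unfolding H_def by (rule slice_coord_holomorphic[OF reg I])
  have hH: "h (slice_pt I z) = slice_pt I (H z)" if z: "z \<in> D" for z
  proof -
    have "h (slice_pt I z) \<in> range (slice_pt I)"
      using img slice_pt_in_iff[OF I, of z] z unfolding slice_plane_eq by blast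
    then show ?thesis using slice_coord_1[OF I] by (auto simp: H_def)
  qed
  obtain g where g: "g \<in> slice_regular \<Omega>" "has_stems I g (re_part H) (im_part H)"
    using slice_regular_of_parts[OF real_on_parts[OF H]] by blast
  have real_eq: "h (of_real x) = g (of_real x)" if "of_real x \<in> \<Omega>" for x
  proof -
    have x: "complex_of_real x \<in> D" using that by (simp add: of_real_in_iff)
    show ?thesis
      using hH[OF x] has_stemsD[OF g(2) I x] slice_pt_parts[OF I, of H "of_real x"] by simp
  qed
  have "h (slice_pt J z) = g (slice_pt J z)" if "J \<in> imag_units" "z \<in> D" for J z
    using that slice_pt_in_iff by (intro slice_regular_eqI[OF reg g(1) real_eq]) auto
  with g(2) have "has_stems I h (re_part H) (im_part H)"
    by (simp add: has_stems_def)
  with H that show thesis by blast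
qed

text \<open>The complex cofactor N extends to a quaternionic one, so the complex order satisfies the
  defining property. Any other exponent is excluded by comparing the factorizations along the real
  line only.\<close>

lemma real_zero_order_eq:
  assumes M: "real_on M" "\<exists>w\<in>D. M w \<noteq> 0"
    and \<mu>: "has_stem \<mu> M"
    and x: "complex_of_real x \<in> D"
  shows "real_zero_order \<Omega> \<mu> x = nat (zorder M (of_real x))"
proof -
  define m where "m = nat (zorder M (of_real x))"
  obtain N where N: "real_on N" "N (of_real x) \<noteq> 0"
    "\<And>w. w \<in> D \<Longrightarrow> M w = N w * (w - of_real x) ^ m"
    using real_on_zero_factor[OF M x] unfolding m_def by blast
  obtain n where n: "n \<in> slice_preserving \<Omega>" "has_stem n N"
    using stem_extension[OF N(1)] by blast
  have n_reg: "n \<in> slice_regular \<Omega>" using n(1) by (simp add: slice_preserving_def)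
  have n_eq: "\<mu> q = (q - of_real x) ^ m * n q" if "q \<in> \<Omega>" for q
    using that
  proof (rule point_cases)
    fix J z assume J: "J \<in> imag_units" and z: "z \<in> D" and q: "q = slice_pt J z"
    have "q - of_real x = slice_pt J (z - of_real x)"
      by (simp add: q slice_pt_diff)
    then have "(q - of_real x) ^ m * n q = slice_pt J ((z - of_real x) ^ m * N z)"
      by (simp add: q has_stemD[OF n(2) J z] slice_pt_mult[OF J] slice_pt_power[OF J])
    then show ?thesis
      by (simp add: q has_stemD[OF \<mu> J z] N(3)[OF z] mult.commute)
  qed
  have n_x: "n (of_real x) \<noteq> 0"
  proof -
    have "n (of_real x) = slice_pt quat_i (N (of_real x))"
      using has_stemD[OF n(2) quat_i_imag x] by simp
    then show ?thesis
      using N(2) slice_coord_1[OF quat_i_imag, of "N (of_real x)"]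
        slice_coord_1[OF quat_i_imag, of 0] by auto
  qed
  have cont: "isCont (\<lambda>t. f (of_real t)) x" if f: "f \<in> slice_regular \<Omega>" for f
  proof -
    obtain c where "((\<lambda>w. f (slice_pt quat_i w)) has_derivative
        (\<lambda>h. slice_pt quat_i h * c)) (at (of_real x))"
      using f x quat_i_imag slice_pt_in_iff[OF quat_i_imag] unfolding slice_regular_iff by blast
    then have "isCont (\<lambda>w. f (slice_pt quat_i w)) (complex_of_real x)"
      by (rule has_derivative_continuous)
    then have "isCont (\<lambda>t. f (slice_pt quat_i (complex_of_real t))) x"
      by (rule isCont_o2[rotated]) (rule isCont_of_real, rule continuous_ident)
    then show ?thesis by simp
  qed
  have of_real_power_mult: "(of_real t - of_real x) ^ k * q = (t - x) ^ k *\<^sub>R q"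
    for t k and q :: quat
  proof -
    have "(of_real t - of_real x) ^ k = (of_real ((t - x) ^ k) :: quat)" by simp
    also have "\<dots> * q = (t - x) ^ k *\<^sub>R q" by (simp add: of_real_def)
    finally show ?thesis .
  qed
  show ?thesis
    unfolding real_zero_order_def m_def[symmetric]
  proof (rule the_equality)
    show "\<exists>\<nu>\<in>slice_regular \<Omega>. (\<forall>q\<in>\<Omega>. \<mu> q = (q - of_real x) ^ m * \<nu> q) \<and> \<nu> (of_real x) \<noteq> 0"
      using n_reg n_eq n_x by blast
    fix k
    assume "\<exists>\<nu>\<in>slice_regular \<Omega>. (\<forall>q\<in>\<Omega>. \<mu> q = (q - of_real x) ^ k * \<nu> q) \<and> \<nu> (of_real x) \<noteq> 0"
    then obtain \<nu> where \<nu>: "\<nu> \<in> slice_regular \<Omega>" "\<forall>q\<in>\<Omega>. \<mu> q = (q - of_real x) ^ k * \<nu> q"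
      "\<nu> (of_real x) \<noteq> 0" by blast
    show "k = m"
    proof (rule power_factor_unique[OF cont[OF \<nu>(1)] \<nu>(3) cont[OF n_reg] n_x])
      show "\<forall>\<^sub>F t in at x. (t - x) ^ k *\<^sub>R \<nu> (of_real t) = (t - x) ^ m *\<^sub>R n (of_real t)"
        using eventually_of_real_in[OF x]
      proof eventually_elim
        case (elim t)
        then have "of_real t \<in> \<Omega>" by (simp add: of_real_in_iff)
        then have "(of_real t - of_real x) ^ k * \<nu> (of_real t) =
            (of_real t - of_real x) ^ m * n (of_real t)"
          using \<nu>(2) n_eq by metis
        then show ?case by (simp only: of_real_power_mult)
      qed
    qed
  qed
qed

end

theorem theorem3p2:
  fixes \<Omega> :: "quat set" and I0 :: quat and \<mu> :: "quat \<Rightarrow> quat"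
  assumes "symmetric_slice_domain \<Omega>"
    and "\<exists>I\<in>imag_units. simply_connected (\<Omega> \<inter> slice_plane I)"
    and "I0 \<in> imag_units"
    and "\<mu> \<in> slice_preserving \<Omega>"
    and "\<exists>q\<in>\<Omega>. \<mu> q \<noteq> 0"
  shows "(\<exists>h \<in> slice_regular_preserving \<Omega> I0. \<forall>q\<in>\<Omega>. symmetrized \<Omega> h q = \<mu> q) \<longleftrightarrow>
         (\<forall>x::real. of_real x \<in> \<Omega> \<longrightarrow> \<mu> (of_real x) \<in> \<real>\<^sub>\<ge>\<^sub>0) \<and>
         (\<forall>x::real. of_real x \<in> \<Omega> \<and> \<mu> (of_real x) = 0 \<longrightarrow> even (real_zero_order \<Omega> \<mu> x))"
    (is "?sym \<longleftrightarrow> ?nonneg \<and> ?even")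
proof -
  interpret slice_domain \<Omega> using assms(1,2) by unfold_locales
  note I0 = assms(3)
  obtain M where M: "real_on M" "has_stem \<mu> M"
    using slice_preserving_stem[OF assms(4)] by blast
  have M_nz: "\<exists>w\<in>D. M w \<noteq> 0"
  proof -
    obtain q where q: "q \<in> \<Omega>" "\<mu> q \<noteq> 0" using assms(5) by blast
    then obtain J z where "J \<in> imag_units" "z \<in> D" "q = slice_pt J z"
      using point_cases by blast
    with q has_stemD[OF M(2)] show ?thesis by force
  qed
  have \<mu>_real: "\<mu> (of_real x) = of_real (Re (M (of_real x)))" if x: "complex_of_real x \<in> D" for x
    using has_stemD[OF M(2) I0 x] real_on_real(1)[OF M(1) x] by (simp add: slice_pt_def)
  have nonneg_iff: "?nonneg \<longleftrightarrow> (\<forall>x. complex_of_real x \<in> D \<longrightarrow> 0 \<le> Re (M (of_real x)))"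
  proof -
    have "(of_real r :: quat) \<in> \<real>\<^sub>\<ge>\<^sub>0 \<longleftrightarrow> 0 \<le> r" for r
      by (auto simp: nonneg_Reals_def)
    then show ?thesis using \<mu>_real by (simp add: of_real_in_iff)
  qed
  have nonneg_imp_even: ?even if ?nonneg
  proof safe
    fix x assume "of_real x \<in> \<Omega>"
    then have x: "complex_of_real x \<in> D" by (simp add: of_real_in_iff)
    obtain N where "real_on N" "N (of_real x) \<noteq> 0"
      "\<And>w. w \<in> D \<Longrightarrow> M w = N w * (w - of_real x) ^ nat (zorder M (of_real x))"
      using real_on_zero_factor[OF M(1) M_nz x] by blast
    then have "even (nat (zorder M (of_real x)))"
      using even_zorder_real[OF _ _ x] that nonneg_iff by blast
    then show "even (real_zero_order \<Omega> \<mu> x)"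
      by (simp only: real_zero_order_eq[OF M(1) M_nz M(2) x])
  qed
  have "?sym \<longleftrightarrow> ?nonneg"
  proof
    assume ?sym
    then obtain h where h: "h \<in> slice_regular_preserving \<Omega> I0"
      "\<forall>q\<in>\<Omega>. symmetrized \<Omega> h q = \<mu> q" by blast
    obtain H where H: "H holomorphic_on D" "has_stems I0 h (re_part H) (im_part H)"
      using slice_regular_preserving_stem[OF I0 h(1)] by blast
    have "0 \<le> Re (M (of_real x))" if x: "complex_of_real x \<in> D" for x
    proof -
      have "slice_pt I0 (M (of_real x)) = symmetrized \<Omega> h (slice_pt I0 (of_real x))"
        using h(2) has_stemD[OF M(2) I0 x] slice_pt_in_iff[OF I0, of "of_real x"] x by simp
      also have "\<dots> = slice_pt I0 (H (of_real x) * cnj (H (of_real x)))"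
      proof -
        have "symmetrized \<Omega> h (slice_pt I0 (of_real x)) =
            slice_pt I0 ((re_part H (of_real x))\<^sup>2 + (im_part H (of_real x))\<^sup>2)"
          by (rule symmetrized_eq[OF real_on_parts[OF H(1)] I0 _ I0 x]) (rule H(2))
        then show ?thesis unfolding re_im_part_norm by simp
      qed
      \<comment> \<open>\<open>slice_pt I0\<close> is injective, so the quaternionic identity is one
        between complex numbers.\<close>
      finally have "M (of_real x) = H (of_real x) * cnj (H (of_real x))"
        by (metis slice_coord_1[OF I0])
      then show ?thesis by (simp add: complex_mult_cnj)
    qed
    then show ?nonneg using nonneg_iff by blast
  next
    assume ?nonneg
    then obtain H where H: "H holomorphic_on D" "\<And>z. z \<in> D \<Longrightarrow> H z * cnj (H (cnj z)) = M z"
      using norm_factorization[OF simply_connected_D M(1) M_nz] nonneg_iff by blast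
    obtain h where h: "h \<in> slice_regular \<Omega>" "has_stems I0 h (re_part H) (im_part H)"
      using slice_regular_of_parts[OF real_on_parts[OF H(1)]] by blast
    \<comment> \<open>In the slice of I0 itself the right factor I0 plays the role of the imaginary
      unit, so the two parts recombine to H and the slice is preserved.\<close>
    have "h (slice_pt I0 z) = slice_pt I0 (H z)" if "z \<in> D" for z
      by (simp only: has_stemsD[OF h(2) I0 that] slice_pt_parts[OF I0])
    then have "h \<in> slice_regular_preserving \<Omega> I0"
      using h(1) slice_pt_in_iff[OF I0] by (auto simp: slice_regular_preserving_def slice_plane_eq)
    moreover have "symmetrized \<Omega> h q = \<mu> q" if "q \<in> \<Omega>" for q
      using that
    proof (rule point_cases)
      fix J z assume J: "J \<in> imag_units" and z: "z \<in> D" and q: "q = slice_pt J z"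
      have "symmetrized \<Omega> h (slice_pt J z) = slice_pt J ((re_part H z)\<^sup>2 + (im_part H z)\<^sup>2)"
        by (rule symmetrized_eq[OF real_on_parts[OF H(1)] I0 _ J z]) (rule h(2))
      then show ?thesis
        by (simp only: q re_im_part_norm H(2)[OF z] has_stemD[OF M(2) J z])
    qed
    ultimately show ?sym by blast
  qed
  with nonneg_imp_even show ?thesis by blast
qed

end
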